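(* Let $a_1,a_2,a_3,b_1,b_2,b_3,\lambda_1,\lambda_2,\lambda_3$ be generic parameters subject to $a_1a_2a_3b_1b_2b_3=q$, and let $$f_1(\lambda)=\lambda\,\theta(b_1/\lambda,b_2/\lambda,b_3/\lambda),\qquad f_2(\lambda)=\lambda^{-1}\theta(a_1\lambda,a_2\lambda,a_3\lambda),$$ $$f_3(\lambda)=\prod_{j=1}^3(q/a_j\lambda,q\lambda/b_j)_\infty\cdot{}_3\psi_3\left(\begin{matrix}a_1\lambda,a_2\lambda,a_3\lambda\\ q\lambda/b_1,q\lambda/b_2,q\lambda/b_3\end{matrix};q\right).$$ Then $$\det_{1\leq i,j\leq 3}\left(f_j(\lambda_i)\right)= \frac{(q)_\infty\,\theta(t\lambda_1\lambda_2\lambda_3)}{\lambda_1\lambda_2\lambda_3}\prod_{i,j=1}^3(q/a_ib_j)_\infty\prod_{1\leq i<j\leq 3}\lambda_j\,\theta(\lambda_i/\lambda_j),$$ where $t=a_1a_2a_3=q/(b_1b_2b_3)$.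
   Context: Throughout, $q$ is a fixed complex number with $0<|q|<1$ (the base $q$ is suppressed from the notation). For $k\in\mathbb Z_{\ge 0}$, $(a)_k=(1-a)(1-aq)\cdots(1-aq^{k-1})$; for $k\in\mathbb Z_{<0}$, $(a)_k=\left((1-aq^{-1})(1-aq^{-2})\cdots(1-aq^{k})\right)^{-1}$; and $(a)_\infty=\prod_{j=0}^\infty(1-aq^j)$. The theta function is $\theta(x)=(x)_\infty(q/x)_\infty$. Repeated arguments denote products, e.g. $\theta(x,y)=\theta(x)\theta(y)$, $(x,y)_\infty=(x)_\infty(y)_\infty$. Here $q/a_j\lambda$ means $q/(a_j\lambda)$ and $q/a_ib_j$ means $q/(a_ib_j)$. The bilateral series is $${}_{r}\psi_r\left(\begin{matrix}\alpha_1,\dots,\alpha_{r}\\ \beta_1,\dots,\beta_r\end{matrix};z\right)=\sum_{k=-\infty}^\infty\frac{(\alpha_1)_k\cdots(\alpha_{r})_k}{(\beta_1)_k\cdots(\beta_r)_k}\,z^k .$$ "Generic" means that all parameters are nonzero complex numbers and that no factor in a denominator (in particular in the terms of the series) vanishes. *)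

theory Defs
  imports "HOL-Analysis.Analysis"
begin

text \<open>
  The base \<open>q\<close>, suppressed in the informal notation, is an explicit first argument throughout.
  For \<open>k < 0\<close> the shifted factorial is the reciprocal of
  \<open>(1 - a / q) (1 - a / q^2) \<dots> (1 - a q^k)\<close>.
\<close>

definition qpoch :: "complex \<Rightarrow> complex \<Rightarrow> int \<Rightarrow> complex" where
  "qpoch q a k =
     (if k \<ge> 0 then \<Prod>j\<in>{0..<k}. 1 - a * q powi j
      else inverse (\<Prod>j\<in>{k..-1}. 1 - a * q powi j))"

definition qpoch_inf :: "complex \<Rightarrow> complex \<Rightarrow> complex" where
  "qpoch_inf q a = (\<Prod>j. 1 - a * q ^ j)"

definition qtheta :: "complex \<Rightarrow> complex \<Rightarrow> complex" where
  "qtheta q x = qpoch_inf q x * qpoch_inf q (q / x)"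

text \<open>
  The common number \<open>r\<close> of upper and lower parameters is the cardinality of the index type.
  The sum is an unconditional one; the series converges absolutely for
  \<open>\<bar>\<Prod>\<beta> / \<Prod>\<alpha>\<bar> < \<bar>z\<bar> < 1\<close>.
\<close>

definition bilateral_psi ::
    "complex \<Rightarrow> complex ^ 'r \<Rightarrow> complex ^ 'r \<Rightarrow> complex \<Rightarrow> complex" where
  "bilateral_psi q \<alpha> \<beta> z =
     (\<Sum>\<^sub>\<infinity>k\<in>(UNIV :: int set).
        (\<Prod>j\<in>UNIV. qpoch q (\<alpha> $ j) k) / (\<Prod>j\<in>UNIV. qpoch q (\<beta> $ j) k) * z powi k)"

definition f1 :: "complex \<Rightarrow> complex ^ 3 \<Rightarrow> complex \<Rightarrow> complex" where
  "f1 q b x = x * (\<Prod>j\<in>UNIV. qtheta q (b $ j / x))"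

definition f2 :: "complex \<Rightarrow> complex ^ 3 \<Rightarrow> complex \<Rightarrow> complex" where
  "f2 q a x = inverse x * (\<Prod>j\<in>UNIV. qtheta q (a $ j * x))"

text \<open>
  In the series below the product of the lower parameters divided by that of the upper ones is
  \<open>q^3 / (a\<^sub>1 a\<^sub>2 a\<^sub>3 b\<^sub>1 b\<^sub>2 b\<^sub>3)\<close>. Under the balancing condition
  \<open>a\<^sub>1 a\<^sub>2 a\<^sub>3 b\<^sub>1 b\<^sub>2 b\<^sub>3 = q\<close> this is \<open>q^2\<close>, so the argument \<open>q\<close> lies in the annulus of
  convergence.
\<close>

definition f3 :: "complex \<Rightarrow> complex ^ 3 \<Rightarrow> complex ^ 3 \<Rightarrow> complex \<Rightarrow> complex" where
  "f3 q a b x =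
     (\<Prod>j\<in>UNIV. qpoch_inf q (q / (a $ j * x)) * qpoch_inf q (q * x / b $ j)) *
     bilateral_psi q (\<chi> j. a $ j * x) (\<chi> j. q * x / b $ j) q"

end

theory Submission
  imports Defs "HOL-Complex_Analysis.Conformal_Mappings"
begin

text \<open>
  Put \<open>t = a\<^sub>1 a\<^sub>2 a\<^sub>3\<close>. Each of the three functions in the determinant is holomorphic on the punctured
  plane and satisfies \<open>f (q x) = - f x / (q t x\<^sup>3)\<close>: for \<open>f1\<close> and \<open>f2\<close> this is the quasi-periodicity of
  the theta function, and for \<open>f3\<close> the substitution \<open>x \<mapsto> q x\<close> only shifts the summation index, once
  the prefactor has been absorbed into the terms of the series. So the determinant is a theta
  function of degree 3 in every \<open>\<lambda>\<^sub>i\<close>, as is the right-hand side, and such a function vanishes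
  identically as soon as it has three zeros, distinct modulo powers of \<open>q\<close>, whose product is not the
  one dictated by the multiplier (\<open>theta_functions_eq_0\<close>).

  This settles the case \<open>a\<^sub>1 b\<^sub>1 = 1\<close> (\<open>theta_det_special\<close>). At \<open>\<lambda>\<^sub>1 = b\<^sub>1\<close> both \<open>f1\<close> and \<open>f2\<close> vanish
  and the series collapses to its term of index \<open>0\<close>, so the determinant is a two-term combination of
  theta products, which Weierstrass's addition formula evaluates. Both sides therefore agree at
  \<open>\<lambda>\<^sub>1 = b\<^sub>1\<close>, and both vanish at \<open>\<lambda>\<^sub>1 = \<lambda>\<^sub>2\<close> and at \<open>\<lambda>\<^sub>1 = \<lambda>\<^sub>3\<close>; for generic \<open>\<lambda>\<^sub>2\<close> and \<open>\<lambda>\<^sub>3\<close> this is enough,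
  and continuity does the rest.

  The general case is reached by varying \<open>a\<^sub>1\<close> and \<open>a\<^sub>2\<close> with \<open>a\<^sub>1 a\<^sub>2\<close> fixed. The terms of the series for
  \<open>(q u, v, a\<^sub>3)\<close> and \<open>(u, q v, a\<^sub>3)\<close> have a linear combination that telescopes
  (\<open>F3_contiguous\<close>). A bilateral sum of differences is the difference of its two limits, and here
  these limits are multiples of \<open>f1\<close> and \<open>f2\<close>, so they drop out of the determinant. Thus the
  determinant and the product of the \<open>(q / a\<^sub>i b\<^sub>j)\<^sub>\<infinity>\<close> change by the same factor, and their quotient is
  invariant under \<open>(a\<^sub>1, a\<^sub>2) \<mapsto> (q a\<^sub>1, a\<^sub>2 / q)\<close>. If \<open>a\<^sub>3\<close> is small, the quotient is holomorphic on an
  annulus of \<open>a\<^sub>1\<close> wider than one period; the maximum modulus principle makes it constant, and its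
  value at \<open>a\<^sub>1 = 1 / b\<^sub>1\<close> is known from the special case (\<open>determinant_formula_annulus\<close>). Finally, the
  same contiguous relation applied to \<open>a\<^sub>3\<close> and \<open>a\<^sub>1\<close> makes \<open>a\<^sub>3\<close> small step by step; the only obstacle
  is a step at which \<open>a\<^sub>3 b\<^sub>j = 1\<close> for some \<open>j\<close>, and this is again the special case
  (\<open>determinant_formula_min\<close>).
\<close>

section \<open>Shifted factorials and the theta function\<close>

locale q_base =
  fixes q :: complex
  assumes norm_q: "0 < cmod q" "cmod q < 1"
begin

lemma q_nonzero [simp]: "q \<noteq> 0"
  using norm_q by auto

lemma summable_norm_q: "summable (\<lambda>n. cmod (a * q ^ n))"
  using norm_q by (auto simp: norm_mult norm_power intro!: summable_mult summable_geometric)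

lemma convergent_prod_q: "convergent_prod (\<lambda>j. 1 - a * q ^ j)"
proof -
  have "abs_convergent_prod (\<lambda>j. 1 - a * q ^ j)"
    unfolding abs_convergent_prod_conv_summable using summable_norm_q[of a] by simp
  then show ?thesis by (rule abs_convergent_prod_imp_convergent_prod)
qed

lemma qpoch_inf_LIMSEQ: "(\<lambda>n. \<Prod>j<n. 1 - a * q ^ j) \<longlonglongrightarrow> qpoch_inf q a"
proof -
  have "(\<lambda>n. \<Prod>j\<le>n. 1 - a * q ^ j) \<longlonglongrightarrow> qpoch_inf q a"
    unfolding qpoch_inf_def by (rule convergent_prod_LIMSEQ[OF convergent_prod_q])
  then show ?thesis
    by (subst LIMSEQ_lessThan_iff_atMost)
qed

lemma qpoch_inf_0 [simp]: "qpoch_inf q 0 = 1"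
  by (simp add: qpoch_inf_def)

lemma qpoch_inf_rec: "qpoch_inf q a = (1 - a) * qpoch_inf q (q * a)"
proof (rule LIMSEQ_unique)
  show "(\<lambda>n. \<Prod>j<Suc n. 1 - a * q ^ j) \<longlonglongrightarrow> qpoch_inf q a"
    by (rule LIMSEQ_Suc[OF qpoch_inf_LIMSEQ])
  have "(\<Prod>j<Suc n. 1 - a * q ^ j) = (1 - a) * (\<Prod>j<n. 1 - q * a * q ^ j)" for n
    by (subst prod.lessThan_Suc_shift) (simp add: mult_ac)
  then show "(\<lambda>n. \<Prod>j<Suc n. 1 - a * q ^ j) \<longlonglongrightarrow> (1 - a) * qpoch_inf q (q * a)"
    by (simp only:) (intro tendsto_mult tendsto_const qpoch_inf_LIMSEQ)
qed

lemma qpoch_inf_eq_0_iff: "qpoch_inf q a = 0 \<longleftrightarrow> (\<exists>n. a * q ^ n = 1)"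
proof -
  have "(\<lambda>j. 1 - a * q ^ j) has_prod qpoch_inf q a"
    unfolding qpoch_inf_def using convergent_prod_q convergent_prod_has_prod_iff by blast
  from has_prod_eq_0_iff[OF this] show ?thesis
    by (simp add: image_iff eq_commute[of 0])
qed

lemma qpoch_inf_1 [simp]: "qpoch_inf q 1 = 0"
  by (subst qpoch_inf_rec) simp

text \<open>
  The bound is uniform in the number of factors. It therefore passes to the infinite product and is
  also what makes the terms of the bilateral series decay geometrically on both sides.
\<close>

lemma norm_qprod_le:
  "cmod (\<Prod>j<n. 1 - a * q ^ j) \<le> exp (cmod a / (1 - cmod q))"
proof -
  have "cmod (\<Prod>j<n. 1 - a * q ^ j) = (\<Prod>j<n. cmod (1 - a * q ^ j))"
    by (simp add: prod_norm)
  also have "\<dots> \<le> (\<Prod>j<n. exp (cmod a * cmod q ^ j))"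
  proof (intro prod_mono conjI norm_ge_zero)
    fix j
    have "cmod (1 - a * q ^ j) \<le> 1 + cmod a * cmod q ^ j"
      by (metis norm_mult norm_one norm_power norm_triangle_ineq4)
    also have "\<dots> \<le> exp (cmod a * cmod q ^ j)"
      by (rule exp_ge_add_one_self)
    finally show "cmod (1 - a * q ^ j) \<le> exp (cmod a * cmod q ^ j)" .
  qed
  also have "\<dots> = exp (cmod a * (\<Sum>j<n. cmod q ^ j))"
    by (simp add: exp_sum sum_distrib_left)
  also have "\<dots> \<le> exp (cmod a / (1 - cmod q))"
  proof -
    have "(\<Sum>j<n. cmod q ^ j) \<le> (\<Sum>j. cmod q ^ j)"
      using norm_q by (intro sum_le_suminf summable_geometric) auto
    also have "\<dots> = 1 / (1 - cmod q)"
      using norm_q by (intro suminf_geometric) auto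
    finally show ?thesis
      by (simp add: mult_left_mono[of _ "1 / (1 - cmod q)", simplified])
  qed
  finally show ?thesis .
qed

lemma norm_qpoch_inf_le: "cmod (qpoch_inf q a) \<le> exp (cmod a / (1 - cmod q))"
  by (rule LIMSEQ_le_const2[OF tendsto_norm[OF qpoch_inf_LIMSEQ[of a]]])
     (use norm_qprod_le in auto)

lemma holomorphic_qpoch_inf: "qpoch_inf q holomorphic_on UNIV"
proof (rule holomorphic_uniform_sequence[where f = "\<lambda>n a. \<Prod>j<n. 1 - a * q ^ j"])
  fix x :: complex
  have "uniformly_convergent_on (cball x 1) (\<lambda>N a. \<Prod>j<N. 1 - a * q ^ j)"
  proof (rule uniformly_convergent_on_prod')
    show "uniformly_convergent_on (cball x 1) (\<lambda>N a. \<Sum>n<N. cmod (1 - a * q ^ n - 1))"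
    proof (rule Weierstrass_m_test')
      fix n a assume "a \<in> cball x 1"
      then have "cmod (a - x) \<le> 1" by (simp add: dist_norm norm_minus_commute)
      then have "cmod a \<le> cmod x + 1"
        using norm_triangle_ineq2[of a x] by linarith
      then show "norm (cmod (1 - a * q ^ n - 1)) \<le> (cmod x + 1) * cmod q ^ n"
        by (simp add: norm_mult norm_power mult_right_mono)
    qed (use norm_q in \<open>auto intro!: summable_mult summable_geometric\<close>)
  qed (auto intro!: continuous_intros)
  then obtain l where l: "uniform_limit (cball x 1) (\<lambda>N a. \<Prod>j<N. 1 - a * q ^ j) l sequentially"
    by (auto simp: uniformly_convergent_on_def)
  have "l a = qpoch_inf q a" if "a \<in> cball x 1" for a
    using tendsto_uniform_limitI[OF l that] qpoch_inf_LIMSEQ[of a] LIMSEQ_unique by blast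
  then have "uniform_limit (cball x 1) (\<lambda>N a. \<Prod>j<N. 1 - a * q ^ j) (qpoch_inf q) sequentially"
    using l uniform_limit_cong'[of "cball x 1" _ _ l "qpoch_inf q"] by fastforce
  then show "\<exists>d. 0 < d \<and> cball x d \<subseteq> UNIV \<and>
      uniform_limit (cball x d) (\<lambda>N a. \<Prod>j<N. 1 - a * q ^ j) (qpoch_inf q) sequentially"
    by (intro exI[of _ 1]) auto
qed (auto intro!: holomorphic_intros)

lemma holomorphic_qpoch_inf' [holomorphic_intros]:
  "f holomorphic_on A \<Longrightarrow> (\<lambda>z. qpoch_inf q (f z)) holomorphic_on A"
  using holomorphic_on_compose_gen[OF _ holomorphic_qpoch_inf, of f A] by (auto simp: o_def)

lemma qpoch_inf_tendsto_1:
  assumes "(f \<longlongrightarrow> 0) F" shows "((\<lambda>x. qpoch_inf q (f x)) \<longlongrightarrow> 1) F"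
proof -
  have "isCont (qpoch_inf q) 0"
    using holomorphic_on_imp_continuous_on[OF holomorphic_qpoch_inf]
    by (simp add: continuous_on_eq_continuous_at)
  then show ?thesis
    using isCont_tendsto_compose[OF _ assms, of "qpoch_inf q"] by simp
qed

lemma qtheta_shift: "x \<noteq> 0 \<Longrightarrow> qtheta q (q * x) = - qtheta q x / x"
  unfolding qtheta_def
  by (simp add: qpoch_inf_rec[of x] qpoch_inf_rec[of "1 / x"] field_simps)

lemma qtheta_reflect: "x \<noteq> 0 \<Longrightarrow> qtheta q (q / x) = qtheta q x"
  unfolding qtheta_def by simp

lemma qtheta_inverse: "x \<noteq> 0 \<Longrightarrow> qtheta q (1 / x) = - qtheta q x / x"
  using qtheta_shift[of "1/x"] qtheta_reflect[of x] by (simp add: field_simps)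

lemma qtheta_1 [simp]: "qtheta q 1 = 0"
  by (simp add: qtheta_def)

lemma qtheta_shift_back: "x \<noteq> 0 \<Longrightarrow> qtheta q (x / q) = - (x / q) * qtheta q x"
  using qtheta_shift[of "x / q"] by (simp add: field_simps)

lemma qtheta_eq_0_iff: "x \<noteq> 0 \<Longrightarrow> qtheta q x = 0 \<longleftrightarrow> (\<exists>m::int. x = q powi m)"
proof
  assume "x \<noteq> 0" "qtheta q x = 0"
  then consider n where "x * q ^ n = 1" | n where "q / x * q ^ n = 1"
    by (auto simp: qtheta_def qpoch_inf_eq_0_iff)
  then show "\<exists>m::int. x = q powi m"
  proof cases
    case 1
    then have "x = q powi (- int n)" by (simp add: power_int_minus field_simps)
    then show ?thesis by blast
  next
    case 2
    then have "x = q powi (int (Suc n))"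
      using \<open>x \<noteq> 0\<close> by (simp add: field_simps del: of_nat_Suc)
    then show ?thesis by blast
  qed
next
  assume "\<exists>m::int. x = q powi m"
  then obtain m where m: "x = q powi m" by blast
  show "qtheta q x = 0"
  proof (cases "m \<le> 0")
    case True
    then have "x * q ^ nat (-m) = 1"
      using m by (simp add: power_int_def field_simps)
    then show ?thesis by (auto simp: qtheta_def qpoch_inf_eq_0_iff)
  next
    case False
    then have "m = int (Suc (nat (m - 1)))" by simp
    then have "x = q ^ Suc (nat (m - 1))"
      using m by (metis power_int_of_nat)
    then have "q / x * q ^ nat (m - 1) = 1" by simp
    then show ?thesis by (auto simp: qtheta_def qpoch_inf_eq_0_iff)
  qed
qed

lemma holomorphic_qtheta [holomorphic_intros]:
  "f holomorphic_on A \<Longrightarrow> (\<And>z. z \<in> A \<Longrightarrow> f z \<noteq> 0) \<Longrightarrow> (\<lambda>z. qtheta q (f z)) holomorphic_on A"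
  unfolding qtheta_def by (intro holomorphic_intros) auto

end

section \<open>Holomorphic functions on the punctured plane\<close>

text \<open>
  The arguments by zeros below need points in general position modulo powers of \<open>q\<close>. The exceptional
  positions form a countable set, whose complement is dense, so that continuity covers them.
\<close>

lemma continuous_agree_off_countable:
  fixes f g :: "complex \<Rightarrow> complex"
  assumes "continuous_on (-{0}) f" "continuous_on (-{0}) g" "countable B"
    and agree: "\<And>z. z \<noteq> 0 \<Longrightarrow> z \<notin> B \<Longrightarrow> f z = g z" and "z \<noteq> 0"
  shows "f z = g z"
proof (rule ccontr)
  assume neq: "f z \<noteq> g z"
  have "open (-{0} \<inter> (\<lambda>w. f w - g w) -` (-{0}))"
    by (intro continuous_open_preimage continuous_intros assms)
  moreover have "z \<in> -{0} \<inter> (\<lambda>w. f w - g w) -` (-{0})"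
    using neq \<open>z \<noteq> 0\<close> by simp
  ultimately obtain e where e: "e > 0" "ball z e \<subseteq> -{0} \<inter> (\<lambda>w. f w - g w) -` (-{0})"
    by (rule openE)
  have "ball z e \<subseteq> B"
  proof
    fix w assume "w \<in> ball z e"
    then have "w \<noteq> 0" "f w \<noteq> g w" using e(2) by auto
    then show "w \<in> B" using agree by blast
  qed
  then show False
    using countable_subset[OF _ \<open>countable B\<close>] uncountable_ball[OF e(1), of z] by blast
qed

text \<open>
  Near a zero \<open>a\<close> of \<open>g\<close> both functions are divisible by \<open>z - a\<close>, and after division the denominator
  is \<open>g' a \<noteq> 0\<close>; this is why the value to be put there is \<open>f' a / g' a\<close>.
\<close>

lemma holomorphic_quotient_simple_zeros:
  fixes f g :: "complex \<Rightarrow> complex"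
  assumes S: "open S" and f: "f holomorphic_on S" and g: "g holomorphic_on S"
    and zero: "\<And>z. z \<in> S \<Longrightarrow> g z = 0 \<Longrightarrow> f z = 0 \<and> deriv g z \<noteq> 0"
  obtains h where "h holomorphic_on S" "\<And>z. z \<in> S \<Longrightarrow> f z = g z * h z"
proof
  define h where "h = (\<lambda>z. if g z = 0 then deriv f z / deriv g z else f z / g z)"
  show "f z = g z * h z" if "z \<in> S" for z
    using zero[OF that] by (auto simp: h_def)
  have "\<exists>T. open T \<and> a \<in> T \<and> T \<subseteq> S \<and> h holomorphic_on T" if a: "a \<in> S" for a
  proof (cases "g a = 0")
    case False
    define T where "T = S \<inter> g -` (-{0})"
    have "open T"
      unfolding T_def
      by (intro continuous_open_preimage holomorphic_on_imp_continuous_on[OF g] S) auto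
    moreover have "h holomorphic_on T"
    proof (rule holomorphic_transform)
      show "(\<lambda>z. f z / g z) holomorphic_on T"
        by (intro holomorphic_intros holomorphic_on_subset[OF f] holomorphic_on_subset[OF g])
           (auto simp: T_def)
    qed (auto simp: T_def h_def)
    ultimately show ?thesis
      using False a by (intro exI[of _ T]) (auto simp: T_def)
  next
    case True
    define F where "F = (\<lambda>z. if z = a then deriv f a else f z / (z - a))"
    define G where "G = (\<lambda>z. if z = a then deriv g a else g z / (z - a))"
    have F: "F holomorphic_on S"
      using zero[OF a True] by (intro pole_theorem_open_0[OF f S, of a]) (auto simp: F_def)
    have G: "G holomorphic_on S"
      using True by (intro pole_theorem_open_0[OF g S, of a]) (auto simp: G_def)
    define T where "T = S \<inter> G -` (-{0})"
    have "open T"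
      unfolding T_def
      by (intro continuous_open_preimage holomorphic_on_imp_continuous_on[OF G] S) auto
    moreover have "h holomorphic_on T"
    proof (rule holomorphic_transform)
      show "(\<lambda>z. F z / G z) holomorphic_on T"
        by (intro holomorphic_intros holomorphic_on_subset[OF F] holomorphic_on_subset[OF G])
           (auto simp: T_def)
      show "F z / G z = h z" if "z \<in> T" for z
        using that True by (auto simp: F_def G_def h_def T_def)
    qed
    moreover have "a \<in> T"
      using zero[OF a True] a by (auto simp: T_def G_def)
    ultimately show ?thesis
      by (intro exI[of _ T]) (auto simp: T_def)
  qed
  then show "h holomorphic_on S"
    by (metis S at_within_open holomorphic_on_def subsetD)
qed

context q_base
begin

definition q_powers :: "complex set" where
  "q_powers = range (\<lambda>m::int. q powi m)"

lemma countable_q_powers: "countable q_powers"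
  by (simp add: q_powers_def)

lemma qtheta_eq_0_iff': "x \<noteq> 0 \<Longrightarrow> qtheta q x = 0 \<longleftrightarrow> x \<in> q_powers"
  by (auto simp: qtheta_eq_0_iff q_powers_def)

text \<open>
  The modulus of \<open>H\<close> attains its maximum on a closed annulus of exactly one period. By periodicity
  this is a maximum over a slightly larger open annulus as well, and there it is attained at an
  interior point, so that the maximum modulus principle applies.
\<close>

lemma q_periodic_on_annulus_constant:
  assumes H: "H holomorphic_on {z. r1 < cmod z \<and> cmod z < r2}"
    and r: "0 \<le> r1" "r1 < cmod q * r2"
    and per: "\<And>z. r1 < cmod (q * z) \<Longrightarrow> cmod z < r2 \<Longrightarrow> H (q * z) = H z"
  shows "H constant_on {z. r1 < cmod z \<and> cmod z < r2}"
proof -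
  let ?U = "{z. r1 < cmod z \<and> cmod z < r2}"
  have "r1 / cmod q < r2" using r norm_q by (simp add: field_simps)
  then obtain r where r': "r1 / cmod q < r" "r < r2" using dense by blast
  have r1: "r1 < cmod q * r" using r' norm_q by (simp add: field_simps)
  have rpos: "0 < r" using r' \<open>0 \<le> r1\<close> norm_q by (meson divide_nonneg_pos le_less_trans)
  have qr: "cmod q * r < r" using rpos norm_q by simp
  let ?A = "{z. cmod q * r \<le> cmod z \<and> cmod z \<le> r}"
  have cl: "closed ?A"
    by (intro closed_Collect_conj closed_Collect_le continuous_intros)
  have "compact ?A"
    unfolding compact_eq_bounded_closed using cl by (auto intro!: boundedI[of _ r])
  moreover have "?A \<noteq> {}"
    using rpos qr by (auto intro!: exI[of _ "of_real r"])
  moreover have AU: "?A \<subseteq> ?U" using r1 r' by auto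
  then have "continuous_on ?A (\<lambda>z. cmod (H z))"
    by (intro continuous_intros holomorphic_on_imp_continuous_on holomorphic_on_subset[OF H])
  ultimately obtain x where x: "x \<in> ?A" "\<And>z. z \<in> ?A \<Longrightarrow> cmod (H z) \<le> cmod (H x)"
    using continuous_attains_sup[of ?A "\<lambda>z. cmod (H z)"] by blast
  let ?W = "{z. max r1 (cmod q * (cmod q * r)) < cmod z \<and> cmod z < min r2 (r / cmod q)}"
  show ?thesis
  proof (rule maximum_modulus_principle[OF H, of ?W x])
    show "open ?U" "open ?W"
      by (intro open_Collect_conj open_Collect_less continuous_intros)+
    show "connected ?U" using connected_annulus(1)[of r1 "0::complex" r2] by simp
    show "?W \<subseteq> ?U" by auto
    show "x \<in> ?W"
    proof -
      have "cmod q * (cmod q * r) < cmod q * r" using qr norm_q by simp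
      moreover have "r < r / cmod q" using qr norm_q by (simp add: field_simps)
      moreover have "cmod q * r \<le> cmod x" "cmod x \<le> r" using x(1) by auto
      ultimately have "r1 < cmod x" "cmod q * (cmod q * r) < cmod x" "cmod x < r2" "cmod x < r / cmod q"
        using r1 r' by linarith+
      then show ?thesis by simp
    qed
    show "cmod (H z) \<le> cmod (H x)" if z: "z \<in> ?W" for z
    proof -
      consider "z \<in> ?A" | "cmod z < cmod q * r" | "cmod z > r" by fastforce
      then show ?thesis
      proof cases
        case 2
        have "z / q \<in> ?A"
          using 2 z norm_q by (auto simp: norm_divide field_simps)
        moreover have "H (q * (z / q)) = H (z / q)"
          using z 2 r' norm_q by (intro per) (auto simp: norm_divide field_simps intro: less_trans)
        ultimately show ?thesis using x(2)[of "z / q"] by simp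
      next
        case 3
        have "q * z \<in> ?A"
          using 3 z norm_q by (auto simp: norm_mult field_simps)
        moreover have "H (q * z) = H z"
        proof (intro per)
          show "r1 < cmod (q * z)"
            using less_trans[OF r1 mult_strict_left_mono[OF 3]] norm_q by (simp add: norm_mult)
        qed (use z in auto)
        ultimately show ?thesis using x(2)[of "q * z"] by simp
      qed (use x in auto)
    qed
  qed
qed

text \<open>
  Multiplying \<open>h\<close> by a power of \<open>x\<close> changes the multiplier by a power of \<open>q\<close>, so one may assume
  \<open>\<bar>q\<bar> < \<bar>\<nu>\<bar> \<le> 1\<close> for the new multiplier \<open>\<nu>\<close>. Then the function is bounded near \<open>0\<close> and grows at most
  linearly at infinity, hence is a polynomial of degree at most one. Comparing coefficients in the
  functional equation leaves only \<open>0\<close>, because \<open>\<nu>\<close> is neither \<open>q\<close> nor \<open>1\<close>.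
\<close>

lemma holomorphic_quasiperiodic_eq_0:
  assumes h: "h holomorphic_on -{0}" and per: "\<And>x. x \<noteq> 0 \<Longrightarrow> h (q * x) = \<mu> * h x"
    and \<mu>: "\<mu> \<notin> q_powers" and "x \<noteq> 0"
  shows "h x = 0"
proof (cases "\<mu> = 0")
  case True
  then show ?thesis using per[of "x / q"] \<open>x \<noteq> 0\<close> by simp
next
  case False
  define s where "s = ln (cmod \<mu>) / ln (cmod q)"
  \<comment> \<open>\<open>\<bar>q\<bar> powr s = \<bar>\<mu>\<bar>\<close>, so rounding \<open>s\<close> down brings the multiplier into the range above.\<close>
  define m where "m = \<lfloor>s\<rfloor>"
  define \<nu> where "\<nu> = \<mu> * q powi (-m)"
  define k where "k = (\<lambda>x. h x * x powi (-m))"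
  have lnq: "ln (cmod q) < 0" using norm_q by (simp add: ln_less_zero)
  have "s - 1 < m" "m \<le> s" unfolding m_def by linarith+
  then have "ln (cmod \<mu>) \<le> m * ln (cmod q)" "(m + 1) * ln (cmod q) < ln (cmod \<mu>)"
    using lnq unfolding s_def by (auto simp: field_simps)
  then have "ln (cmod \<mu>) + - m * ln (cmod q) \<le> ln 1" "ln (cmod q) < ln (cmod \<mu>) + -m * ln (cmod q)"
    by (auto simp: field_simps)
  moreover have "ln (cmod \<nu>) = ln (cmod \<mu>) + - m * ln (cmod q)"
    using False norm_q
    by (simp add: \<nu>_def norm_mult norm_power_int ln_mult ln_powr flip: powr_real_of_int')
  moreover have \<nu>pos: "0 < cmod \<nu>" using False by (simp add: \<nu>_def)
  ultimately have \<nu>: "cmod \<nu> \<le> 1" "cmod q < cmod \<nu>"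
    using norm_q by (metis ln_le_cancel_iff zero_less_one, metis ln_less_cancel_iff)
  have kper: "k (q * x) = \<nu> * k x" if "x \<noteq> 0" for x
    using per[OF that] by (simp add: k_def \<nu>_def power_int_mult_distrib)
  have holk: "k holomorphic_on -{0}"
    unfolding k_def by (intro holomorphic_intros h) auto
  let ?A = "{z. cmod q \<le> cmod z \<and> cmod z \<le> 1}"
  have "closed ?A"
    by (intro closed_Collect_conj closed_Collect_le continuous_intros)
  then have "compact ?A"
    unfolding compact_eq_bounded_closed by (auto intro!: boundedI[of _ 1])
  moreover have "continuous_on ?A k"
    using norm_q by (intro holomorphic_on_imp_continuous_on holomorphic_on_subset[OF holk]) auto
  ultimately have "bounded (k ` ?A)"
    by (intro compact_imp_bounded compact_continuous_image)
  then obtain B where B: "B > 0" "\<And>z. z \<in> ?A \<Longrightarrow> cmod (k z) \<le> B"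
    unfolding bounded_pos by auto
  have small: "cmod (k x) \<le> B" if "cmod q ^ N \<le> cmod x" "cmod x \<le> 1" for N x
    using that
  proof (induction N arbitrary: x)
    case 0
    then show ?case using B norm_q by auto
  next
    case (Suc N)
    show ?case
    proof (cases "cmod q \<le> cmod x")
      case True
      then show ?thesis using B Suc by auto
    next
      case False
      have "cmod q ^ Suc N > 0" using norm_q by simp
      then have x0: "x \<noteq> 0" using Suc.prems(1) by (metis norm_zero not_less)
      have "cmod (k (x / q)) \<le> B"
        using Suc.prems False norm_q by (intro Suc.IH) (auto simp: norm_divide field_simps)
      moreover have "cmod (k x) = cmod \<nu> * cmod (k (x / q))"
        using kper[of "x / q"] x0 by (simp add: norm_mult)
      ultimately show ?thesis
        using \<nu> mult_left_le_one_le[of "cmod (k (x / q))" "cmod \<nu>"] by simp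
    qed
  qed
  have small': "cmod (k x) \<le> B" if "x \<noteq> 0" "cmod x \<le> 1" for x
  proof -
    have "0 < cmod x" using that by simp
    then obtain N where "cmod q ^ N < cmod x"
      using real_arch_pow_inv norm_q(2) by blast
    then show ?thesis using small that less_imp_le by blast
  qed
  have large: "cmod (k x) \<le> B / cmod q * cmod x" if "cmod q \<le> cmod x" "cmod q ^ N * cmod x \<le> 1" for N x
    using that
  proof (induction N arbitrary: x)
    case 0
    then have "cmod (k x) \<le> B" using B by auto
    also have "\<dots> \<le> B / cmod q * cmod x"
      using 0 norm_q B by (simp add: field_simps)
    finally show ?case .
  next
    case (Suc N)
    have x0: "x \<noteq> 0" using Suc.prems norm_q by auto
    show ?case
    proof (cases "cmod x \<le> 1")
      case True
      then have "cmod (k x) \<le> B" using B Suc by auto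
      also have "\<dots> \<le> B / cmod q * cmod x"
        using Suc norm_q B by (simp add: field_simps)
      finally show ?thesis .
    next
      case False
      have "cmod \<nu> * cmod (k x) = cmod (k (q * x))"
        using kper[OF x0] by (simp add: norm_mult)
      also have "\<dots> \<le> B / cmod q * cmod (q * x)"
        using Suc.prems False norm_q by (intro Suc.IH) (auto simp: norm_mult field_simps)
      also have "\<dots> = cmod q * (B / cmod q * cmod x)" by (simp add: norm_mult)
      also have "\<dots> \<le> cmod \<nu> * (B / cmod q * cmod x)"
        using \<nu> B by (intro mult_right_mono) auto
      finally show ?thesis using mult_le_cancel_left_pos[OF \<nu>pos] by blast
    qed
  qed
  have large': "cmod (k x) \<le> B / cmod q * cmod x" if "1 \<le> cmod x" for x
  proof -
    have "0 < cmod x" using that by linarith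
    then have "0 < 1 / cmod x" by simp
    then obtain N where "cmod q ^ N < 1 / cmod x"
      using real_arch_pow_inv norm_q(2) by blast
    with \<open>0 < cmod x\<close> have "cmod q ^ N * cmod x \<le> 1" by (simp add: field_simps)
    then show ?thesis using large[of x N] that norm_q by linarith
  qed
  have "\<exists>g. g holomorphic_on UNIV \<and> (\<forall>z\<in>UNIV - {0}. g z = k z)"
  proof (subst holomorphic_on_extend_bounded)
    show "k holomorphic_on UNIV - {0}" using holk by (simp add: Compl_eq_Diff_UNIV)
    show "\<exists>B. \<forall>\<^sub>F z in at 0. cmod (k z) \<le> B"
      using small' by (intro exI[of _ B]) (auto simp: eventually_at intro!: exI[of _ 1])
  qed auto
  then obtain g where g: "g holomorphic_on UNIV" "\<And>z. z \<noteq> 0 \<Longrightarrow> g z = k z" by auto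
  define c0 c1 where "c0 = g 0" and "c1 = deriv g 0"
  have lin: "g z = c0 + c1 * z" for z
  proof -
    have "g z = (\<Sum>k\<le>1. (deriv ^^ k) g 0 / fact k * z ^ k)"
    proof (rule Liouville_polynomial[OF g(1)])
      fix z :: complex assume "1 \<le> cmod z"
      then show "cmod (g z) \<le> B / cmod q * cmod z ^ 1"
        using large'[of z] g(2)[of z] by fastforce
    qed
    then show ?thesis by (simp add: c0_def c1_def)
  qed
  have eq: "c0 + c1 * (q * z) = \<nu> * (c0 + c1 * z)" if "z \<noteq> 0" for z
    by (metis kper[OF that] g(2) that lin mult_eq_0_iff q_nonzero)
  have e: "c0 + c1 * q = \<nu> * (c0 + c1)" "c0 - c1 * q = \<nu> * (c0 - c1)"
    using eq[of 1] eq[of "-1"] by simp_all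
  have "2 * (c1 * q) = (c0 + c1 * q) - (c0 - c1 * q)" by simp
  also have "\<dots> = 2 * (\<nu> * c1)" unfolding e by (simp add: algebra_simps)
  finally have c1: "c1 * q = \<nu> * c1" unfolding mult_cancel_left by simp
  moreover have "c0 = \<nu> * c0" using e(1) unfolding c1 by (simp only: distrib_left add_right_cancel)
  moreover have "\<nu> \<noteq> q" using \<nu> by auto
  moreover have "\<nu> \<noteq> 1"
  proof
    assume "\<nu> = 1"
    then have "\<mu> = q powi m" by (simp add: \<nu>_def power_int_minus field_simps)
    then show False using \<mu> by (auto simp: q_powers_def)
  qed
  ultimately have "c0 = 0" "c1 = 0" by auto
  then have "k x = 0" using lin[of x] g(2)[OF \<open>x \<noteq> 0\<close>] by simp
  then show ?thesis using \<open>x \<noteq> 0\<close> by (simp add: k_def)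
qed

section \<open>Theta functions of given degree and multiplier\<close>

text \<open>
  At \<open>1\<close> the factor \<open>1 - x\<close> splits off and the cofactor is \<open>(q)\<^sub>\<infinity>\<^sup>2 \<noteq> 0\<close>. Differentiating the functional
  equation at a zero carries this to all other powers of \<open>q\<close>, in both directions.
\<close>

lemma qtheta_simple_zeros:
  "\<exists>D. D \<noteq> 0 \<and> (qtheta q has_field_derivative D) (at (q powi m))"
proof (induction m rule: int_induct[of _ 0])
  case base
  define R where "R = (\<lambda>x. qpoch_inf q (q * x) * qpoch_inf q (q / x))"
  have eq: "(1 - x) * R x = qtheta q x" for x
    using qpoch_inf_rec[of x] by (simp add: R_def qtheta_def)
  have "qpoch_inf q q \<noteq> 0"
  proof
    assume "qpoch_inf q q = 0"
    then obtain n where "q ^ Suc n = 1" by (auto simp: qpoch_inf_eq_0_iff)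
    then have "cmod q ^ Suc n = 1" by (metis norm_one norm_power)
    then show False using norm_q power_Suc_less_one[of "cmod q" n] by simp
  qed
  then have R1: "R 1 \<noteq> 0" by (simp add: R_def)
  have "R holomorphic_on -{0}" unfolding R_def by (intro holomorphic_intros) auto
  then have "(R has_field_derivative deriv R 1) (at 1)"
    by (intro holomorphic_derivI[of _ "-{0}"]) auto
  then have "((\<lambda>x. (1 - x) * R x) has_field_derivative - R 1) (at 1)"
    by (auto intro!: derivative_eq_intros)
  then show ?case using R1 by (intro exI[of _ "- R 1"]) (simp add: eq)
next
  case (step1 i)
  then obtain D where D: "D \<noteq> 0" "(qtheta q has_field_derivative D) (at (q powi i))" by blast
  let ?y = "q powi (i + 1)"
  have z: "qtheta q (q powi i) = 0" by (subst qtheta_eq_0_iff) auto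
  have y: "?y / q = q powi i" "?y \<noteq> 0" by (auto simp: power_int_add_1)
  have "((\<lambda>y. qtheta q (y / q)) has_field_derivative D * (1 / q)) (at ?y)"
    by (rule DERIV_chain'[of "\<lambda>y. y / q" _ _ _ "qtheta q"])
       (use D y in \<open>auto intro!: derivative_eq_intros\<close>)
  then have "((\<lambda>y. - q * qtheta q (y / q) / y) has_field_derivative - D / ?y) (at ?y)"
    using z y by (auto intro!: derivative_eq_intros simp: field_simps)
  then have "(qtheta q has_field_derivative - D / ?y) (at ?y)"
    by (rule has_field_derivative_transform_within_open[of _ _ _ "-{0}"])
       (auto simp: qtheta_shift_back)
  then show ?case using D by (intro exI[of _ "- D / ?y"]) auto
next
  case (step2 i)
  then obtain D where D: "D \<noteq> 0" "(qtheta q has_field_derivative D) (at (q powi i))" by blast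
  let ?y = "q powi (i - 1)"
  have z: "qtheta q (q powi i) = 0" by (subst qtheta_eq_0_iff) auto
  have y: "q * ?y = q powi i" "?y \<noteq> 0" by (auto simp: power_int_diff)
  have "((\<lambda>y. qtheta q (q * y)) has_field_derivative D * q) (at ?y)"
    by (rule DERIV_chain'[of "\<lambda>y. q * y" _ _ _ "qtheta q"])
       (use D y in \<open>auto intro!: derivative_eq_intros\<close>)
  then have "((\<lambda>y. - y * qtheta q (q * y)) has_field_derivative - ?y * (D * q)) (at ?y)"
    using z y by (auto intro!: derivative_eq_intros simp: field_simps)
  then have "(qtheta q has_field_derivative - ?y * (D * q)) (at ?y)"
    by (rule has_field_derivative_transform_within_open[of _ _ _ "-{0}"])
       (auto simp: qtheta_shift)
  then show ?case using D by (intro exI[of _ "- ?y * (D * q)"]) auto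
qed

definition theta_functions :: "int \<Rightarrow> complex \<Rightarrow> (complex \<Rightarrow> complex) set" where
  "theta_functions n c =
     {f. f holomorphic_on -{0} \<and> (\<forall>x. x \<noteq> 0 \<longrightarrow> f (q * x) = c * x powi (-n) * f x)}"

lemma theta_functions_diff:
  "f \<in> theta_functions n c \<Longrightarrow> g \<in> theta_functions n c \<Longrightarrow> (\<lambda>x. f x - g x) \<in> theta_functions n c"
  by (auto simp: theta_functions_def right_diff_distrib intro!: holomorphic_intros)

lemma theta_functions_add:
  "f \<in> theta_functions n c \<Longrightarrow> g \<in> theta_functions n c \<Longrightarrow> (\<lambda>x. f x + g x) \<in> theta_functions n c"
  by (auto simp: theta_functions_def distrib_left intro!: holomorphic_intros)

lemma theta_functions_cmult:
  "f \<in> theta_functions n c \<Longrightarrow> (\<lambda>x. K * f x) \<in> theta_functions n c"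
  by (auto simp: theta_functions_def intro!: holomorphic_intros)

lemma theta_functions_zero_orbit:
  assumes f: "f \<in> theta_functions n c" and "c \<noteq> 0" "p \<noteq> 0" "f p = 0"
  shows "f (p * q powi m) = 0"
proof (induction m rule: int_induct[of _ 0])
  case base
  then show ?case using assms by simp
next
  case (step1 i)
  have "f (q * (p * q powi i)) = 0"
    using f step1 \<open>p \<noteq> 0\<close> by (auto simp: theta_functions_def)
  then show ?case by (simp add: power_int_add_1 mult_ac)
next
  case (step2 i)
  let ?x = "p * q powi (i - 1)"
  have "f (q * ?x) = c * ?x powi (-n) * f ?x"
    using f \<open>p \<noteq> 0\<close> by (auto simp: theta_functions_def)
  moreover have "q * ?x = p * q powi i" by (simp add: power_int_diff)
  ultimately show ?case using step2 assms by auto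
qed

text \<open>
  A zero of \<open>f\<close> at \<open>p\<close> spreads to the orbit \<open>p q\<^sup>m\<close>, which is the zero set of \<open>\<theta>(x / p)\<close>, and all zeros of
  the latter are simple. So one zero can be divided out at the price of one degree.
\<close>

lemma theta_functions_divide:
  assumes f: "f \<in> theta_functions n c" and "c \<noteq> 0" "p \<noteq> 0" "f p = 0"
  shows "\<exists>g \<in> theta_functions (n - 1) (- c / p). \<forall>x. x \<noteq> 0 \<longrightarrow> f x = qtheta q (x / p) * g x"
proof -
  define \<theta> where "\<theta> = (\<lambda>x. qtheta q (x / p))"
  have hol\<theta>: "\<theta> holomorphic_on -{0}"
    unfolding \<theta>_def using \<open>p \<noteq> 0\<close> by (intro holomorphic_intros) auto
  have "f z = 0 \<and> deriv \<theta> z \<noteq> 0" if z: "z \<in> -{0}" "\<theta> z = 0" for z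
  proof -
    obtain m where "z / p = q powi m"
      using z \<open>p \<noteq> 0\<close> by (auto simp: \<theta>_def qtheta_eq_0_iff)
    then have m: "z = p * q powi m" using \<open>p \<noteq> 0\<close> by (simp add: field_simps)
    obtain D where D: "D \<noteq> 0" "(qtheta q has_field_derivative D) (at (q powi m))"
      using qtheta_simple_zeros by blast
    have "(\<theta> has_field_derivative D * (1 / p)) (at z)"
      unfolding \<theta>_def
      by (rule DERIV_chain'[of "\<lambda>y. y / p" _ _ _ "qtheta q"])
         (use D m \<open>p \<noteq> 0\<close> in \<open>auto intro!: derivative_eq_intros\<close>)
    then have "deriv \<theta> z = D * (1 / p)" by (rule DERIV_imp_deriv)
    then show ?thesis
      using D \<open>p \<noteq> 0\<close> theta_functions_zero_orbit[OF assms, of m] by (auto simp: m)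
  qed
  then obtain g where g: "g holomorphic_on -{0}" "\<And>x. x \<in> -{0} \<Longrightarrow> f x = \<theta> x * g x"
    using holomorphic_quotient_simple_zeros[of "-{0}" f \<theta>] f hol\<theta>
    by (auto simp: theta_functions_def)
  have "g (q * x) = - c / p * x powi (- (n - 1)) * g x" if "x \<noteq> 0" for x
  proof (rule continuous_agree_off_countable[of "\<lambda>x. g (q * x)" _ "(\<lambda>x. p * x) ` q_powers"])
    have "(g \<circ> (\<lambda>x. q * x)) holomorphic_on -{0}"
      by (rule holomorphic_on_compose_gen[OF _ g(1)]) (auto intro!: holomorphic_intros)
    then have "(\<lambda>x. g (q * x)) holomorphic_on -{0}" by (simp add: o_def)
    then show "continuous_on (-{0}) (\<lambda>x. g (q * x))"
      by (rule holomorphic_on_imp_continuous_on)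
    show "continuous_on (-{0}) (\<lambda>x. - c / p * x powi (- (n - 1)) * g x)"
      by (intro holomorphic_on_imp_continuous_on holomorphic_intros g) auto
    show "countable ((\<lambda>x. p * x) ` q_powers)" by (simp add: countable_q_powers)
    fix x assume x: "x \<noteq> 0" "x \<notin> (\<lambda>x. p * x) ` q_powers"
    then have "x / p \<notin> q_powers" using \<open>p \<noteq> 0\<close> by (force simp: image_iff)
    then have \<theta>0: "\<theta> x \<noteq> 0" using x \<open>p \<noteq> 0\<close> by (simp add: \<theta>_def qtheta_eq_0_iff')
    have 1: "\<theta> (q * x) * g (q * x) = c * x powi (-n) * (\<theta> x * g x)"
      using f g(2)[of x] g(2)[of "q * x"] x by (auto simp: theta_functions_def)
    have 2: "x * \<theta> (q * x) = - p * \<theta> x"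
      using qtheta_shift[of "x / p"] x \<open>p \<noteq> 0\<close> by (simp add: \<theta>_def)
    have 3: "x powi (- (n - 1)) = x powi (-n) * x"
      using x by (simp add: power_int_diff power_int_minus field_simps)
    have "\<theta> x * (- p * g (q * x)) = x * (\<theta> (q * x) * g (q * x))"
      using arg_cong[OF 2, of "\<lambda>t. t * g (q * x)"] by (simp only: mult_ac minus_mult_right minus_mult_left)
    also have "\<dots> = \<theta> x * (c * x powi (- (n - 1)) * g x)"
      unfolding 1 3 by (simp only: mult_ac)
    finally have "- p * g (q * x) = c * x powi (- (n - 1)) * g x"
      unfolding mult_cancel_left using \<theta>0 by simp
    then have eq: "p * g (q * x) = - (c * x powi (- (n - 1)) * g x)"
      by (simp only: mult_minus_left minus_equation_iff[of "p * _"])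
    have "g (q * x) = p * g (q * x) / p" using \<open>p \<noteq> 0\<close> by simp
    then show "g (q * x) = - c / p * x powi (- (n - 1)) * g x"
      unfolding eq by simp
  qed fact
  then have "g \<in> theta_functions (n - 1) (- c / p)"
    using g(1) by (simp add: theta_functions_def)
  then show ?thesis
    by (rule bexI[rotated]) (use g(2) in \<open>simp add: \<theta>_def\<close>)
qed

text \<open>
  Dividing out as many zeros as the degree leaves a quasi-periodic function of degree \<open>0\<close>, which
  vanishes unless its multiplier is a power of \<open>q\<close>. This is the statement that the product of the
  zeros of a nonzero theta function is determined, modulo powers of \<open>q\<close>, by its multiplier.
\<close>

lemma theta_functions_eq_0:
  assumes "f \<in> theta_functions (int (length ps)) c" "c \<noteq> 0" "0 \<notin> set ps"
    and "\<And>p. p \<in> set ps \<Longrightarrow> f p = 0"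
    and "sorted_wrt (\<lambda>p p'. p' / p \<notin> q_powers) ps"
    and "c * (- 1) ^ length ps / prod_list ps \<notin> q_powers"
    and "x \<noteq> 0"
  shows "f x = 0"
  using assms
proof (induction ps arbitrary: f c)
  case Nil
  then show ?case
    by (intro holomorphic_quasiperiodic_eq_0[of f c]) (auto simp: theta_functions_def)
next
  case (Cons p ps)
  have p: "p \<noteq> 0" "f p = 0" using Cons.prems(3,4) by simp_all
  obtain g where g: "g \<in> theta_functions (int (length (p # ps)) - 1) (- c / p)"
    "\<And>x. x \<noteq> 0 \<Longrightarrow> f x = qtheta q (x / p) * g x"
    using theta_functions_divide[OF Cons.prems(1,2) p] by metis
  have "g x = 0"
  proof (rule Cons.IH)
    show "g \<in> theta_functions (int (length ps)) (- c / p)" using g(1) by simp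
    show "- c / p \<noteq> 0" "0 \<notin> set ps" using p Cons.prems(2,3) by simp_all
    show "g p' = 0" if "p' \<in> set ps" for p'
    proof -
      have "p' \<noteq> 0" using Cons.prems(3) that by fastforce
      moreover have "p' / p \<notin> q_powers" using Cons.prems(5) that by simp
      ultimately have "qtheta q (p' / p) \<noteq> 0" using p by (simp add: qtheta_eq_0_iff')
      moreover have "f p' = 0" using Cons.prems(4) that by simp
      ultimately show ?thesis using g(2)[OF \<open>p' \<noteq> 0\<close>] by simp
    qed
    show "sorted_wrt (\<lambda>p p'. p' / p \<notin> q_powers) ps" using Cons.prems(5) by simp
    have "- c / p * (- 1) ^ length ps / prod_list ps = c * (- 1) ^ length (p # ps) / prod_list (p # ps)"
      by simp
    then show "- c / p * (- 1) ^ length ps / prod_list ps \<notin> q_powers"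
      using Cons.prems(6) by metis
  qed fact
  then show ?case using g(2)[OF \<open>x \<noteq> 0\<close>] by simp
qed

end

section \<open>Bilateral series with geometric decay\<close>

lemma bilateral_series:
  fixes f :: "int \<Rightarrow> complex"
  assumes f: "\<And>k. cmod (f k) \<le> M * r ^ nat \<bar>k\<bar>" and r: "0 \<le> r" "r < 1"
  shows bilateral_summable: "f summable_on UNIV"
    and bilateral_sums: "(\<lambda>n. f (int n) + f (- int n - 1)) sums infsum f UNIV"
proof -
  have M: "0 \<le> M" using f[of 0] by (simp add: order_trans[OF norm_ge_zero])
  have split: "UNIV = range int \<union> range (\<lambda>n. - int n - 1)"
  proof -
    have "k \<in> range int \<union> range (\<lambda>n. - int n - 1)" for k :: int
    proof (cases "k \<ge> 0")
      case True
      then have "k = int (nat k)" by simp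
      then show ?thesis by blast
    next
      case False
      then have "k = - int (nat (- k - 1)) - 1" by simp
      then show ?thesis by blast
    qed
    then show ?thesis by blast
  qed
  have disj: "range int \<inter> range (\<lambda>n. - int n - 1) = {}" by auto
  have bij: "bij_betw int UNIV (range int)"
    "bij_betw (\<lambda>n. - int n - 1) UNIV (range (\<lambda>n. - int n - 1))"
    by (auto simp: bij_betw_def inj_on_def)
  have geom: "summable (\<lambda>n. M * r ^ n)"
    using r by (intro summable_mult summable_geometric) auto
  have sum1: "summable (\<lambda>n. norm (f (int n)))"
  proof (rule summable_comparison_test'[OF geom])
    show "norm (norm (f (int n))) \<le> M * r ^ n" for n using f[of "int n"] by simp
  qed
  have "cmod (f (- int n - 1)) \<le> M * r ^ n" for n
  proof -
    have "nat \<bar>- int n - 1\<bar> = Suc n" by simp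
    then have "cmod (f (- int n - 1)) \<le> M * r ^ Suc n" using f[of "- int n - 1"] by simp
    also have "\<dots> \<le> M * r ^ n" using r M by (intro mult_left_mono) (auto intro: mult_left_le_one_le)
    finally show ?thesis .
  qed
  then have sum2: "summable (\<lambda>n. norm (f (- int n - 1)))"
    by (intro summable_comparison_test'[OF geom]) simp
  obtain a b where a: "((\<lambda>n. f (int n)) has_sum a) UNIV" and b: "((\<lambda>n. f (- int n - 1)) has_sum b) UNIV"
    using norm_summable_imp_summable_on[OF sum1] norm_summable_imp_summable_on[OF sum2]
    unfolding summable_on_def by blast
  have "(f has_sum (a + b)) UNIV"
    unfolding split
    by (intro has_sum_Un_disjoint disj)
       (use a b has_sum_reindex_bij_betw[OF bij(1), of f] has_sum_reindex_bij_betw[OF bij(2), of f] in auto)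
  then show "f summable_on UNIV" "(\<lambda>n. f (int n) + f (- int n - 1)) sums infsum f UNIV"
    using sums_add[OF has_sum_imp_sums[OF a] has_sum_imp_sums[OF b]]
    by (auto simp: summable_on_def infsumI)
qed

lemma bilateral_telescoping:
  fixes f G :: "int \<Rightarrow> complex"
  assumes f: "\<And>k. cmod (f k) \<le> M * r ^ nat \<bar>k\<bar>" and r: "0 \<le> r" "r < 1"
    and G: "\<And>k. f k = G (k + 1) - G k"
    and lim: "(\<lambda>n. G (int n)) \<longlonglongrightarrow> L" "(\<lambda>n. G (- int n)) \<longlonglongrightarrow> L'"
  shows "infsum f UNIV = L - L'"
proof (rule LIMSEQ_unique)
  show "(\<lambda>N. \<Sum>n<N. f (int n) + f (- int n - 1)) \<longlonglongrightarrow> infsum f UNIV"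
    using bilateral_sums[OF f r] by (simp add: sums_def)
  have "(\<Sum>n<N. f (int n) + f (- int n - 1)) = G (int N) - G (- int N)" for N
  proof (induction N)
    case (Suc N)
    have e: "- int (Suc N) = - int N - 1" "int (Suc N) = int N + 1" by simp_all
    have "(\<Sum>n<Suc N. f (int n) + f (- int n - 1)) =
        (G (int N) - G (- int N)) + (f (int N) + f (- int N - 1))"
      by (simp only: sum.lessThan_Suc Suc)
    also have "\<dots> = G (int N + 1) - G (- int N - 1)" by (simp add: G)
    finally show ?case by (simp only: e(1)[symmetric] e(2)[symmetric])
  qed simp
  then show "(\<lambda>N. \<Sum>n<N. f (int n) + f (- int n - 1)) \<longlonglongrightarrow> L - L'"
    using tendsto_diff[OF lim] by simp
qed

lemma holomorphic_bilateral_series: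
  fixes F :: "int \<Rightarrow> complex \<Rightarrow> complex"
  assumes S: "open S" and hol: "\<And>k. F k holomorphic_on S"
    and F: "\<And>k z. z \<in> S \<Longrightarrow> cmod (F k z) \<le> M z * r ^ nat \<bar>k\<bar>" and r: "0 \<le> r" "r < 1"
    and M: "continuous_on S M"
  shows "(\<lambda>z. infsum (\<lambda>k. F k z) UNIV) holomorphic_on S"
proof (rule holomorphic_uniform_sequence[OF S,
      where f = "\<lambda>N z. \<Sum>n<N. F (int n) z + F (- int n - 1) z"])
  show "(\<lambda>z. \<Sum>n<N. F (int n) z + F (- int n - 1) z) holomorphic_on S" for N
    by (intro holomorphic_intros hol)
  fix x assume "x \<in> S"
  then obtain d where d: "d > 0" "cball x d \<subseteq> S"
    using S open_contains_cball by blast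
  have "compact (M ` cball x d)"
    by (intro compact_continuous_image continuous_on_subset[OF M d(2)]) auto
  then have "bounded (M ` cball x d)" by (rule compact_imp_bounded)
  then obtain C where C: "C > 0" "\<And>y. y \<in> M ` cball x d \<Longrightarrow> norm y \<le> C"
    unfolding bounded_pos by metis
  have le: "cmod (F k z) \<le> C * r ^ nat \<bar>k\<bar>" if z: "z \<in> cball x d" for k z
  proof -
    have "cmod (F k z) \<le> M z * r ^ nat \<bar>k\<bar>" using F d(2) z by blast
    also have "\<dots> \<le> C * r ^ nat \<bar>k\<bar>"
      using C(2)[of "M z"] z r by (intro mult_right_mono) auto
    finally show ?thesis .
  qed
  have "uniform_limit (cball x d) (\<lambda>N z. \<Sum>n<N. F (int n) z + F (- int n - 1) z)
          (\<lambda>z. \<Sum>n. F (int n) z + F (- int n - 1) z) sequentially"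
  proof (rule Weierstrass_m_test[where M = "\<lambda>n. 2 * C * r ^ n"])
    fix n z assume z: "z \<in> cball x d"
    have "nat \<bar>- int n - 1\<bar> = Suc n" by simp
    then have "cmod (F (- int n - 1) z) \<le> C * r ^ Suc n" using le[OF z, of "- int n - 1"] by simp
    also have "\<dots> \<le> C * r ^ n"
      using r C by (intro mult_left_mono) (auto intro: mult_left_le_one_le)
    finally have "cmod (F (- int n - 1) z) \<le> C * r ^ n" .
    moreover have "cmod (F (int n) z) \<le> C * r ^ n" using le[OF z, of "int n"] by simp
    ultimately show "cmod (F (int n) z + F (- int n - 1) z) \<le> 2 * C * r ^ n"
      using norm_triangle_ineq[of "F (int n) z" "F (- int n - 1) z"] by linarith
  qed (use r in \<open>auto intro!: summable_mult summable_geometric\<close>)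
  moreover have "(\<Sum>n. F (int n) z + F (- int n - 1) z) = infsum (\<lambda>k. F k z) UNIV"
    if "z \<in> cball x d" for z
    using bilateral_sums[OF le[OF that] r] by (rule sums_unique[symmetric])
  ultimately have "uniform_limit (cball x d) (\<lambda>N z. \<Sum>n<N. F (int n) z + F (- int n - 1) z)
          (\<lambda>z. infsum (\<lambda>k. F k z) UNIV) sequentially"
    by (subst (asm) uniform_limit_cong'[where g = "\<lambda>N z. \<Sum>n<N. F (int n) z + F (- int n - 1) z"
          and i = "\<lambda>z. infsum (\<lambda>k. F k z) UNIV"]) simp_all
  then show "\<exists>d>0. cball x d \<subseteq> S \<and> uniform_limit (cball x d)
      (\<lambda>N z. \<Sum>n<N. F (int n) z + F (- int n - 1) z) (\<lambda>z. infsum (\<lambda>k. F k z) UNIV) sequentially"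
    using d by blast
qed

context q_base
begin

section \<open>The regularised bilateral series\<close>

text \<open>
  This is \<open>(q / x)\<^sub>\<infinity> (x)\<^sub>k\<close>, written such that it makes sense for every \<open>x \<noteq> 0\<close>: the poles of \<open>(x)\<^sub>k\<close> for
  \<open>k < 0\<close> are cancelled by zeros of \<open>(q / x)\<^sub>\<infinity>\<close>.
\<close>

definition upper_factor :: "complex \<Rightarrow> int \<Rightarrow> complex" where
  "upper_factor x k = (- x) powi k * q powi (k * (k - 1) div 2) * qpoch_inf q (q powi (1 - k) / x)"

text \<open>
  This is \<open>(q y)\<^sub>\<infinity> / (q y)\<^sub>k\<close>.
\<close>

definition lower_factor :: "complex \<Rightarrow> int \<Rightarrow> complex" where
  "lower_factor y k = qpoch_inf q (q powi (k + 1) * y)"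

lemma triangle_Suc: "(k + 1) * k div 2 = k * (k - 1) div 2 + (k::int)"
proof -
  have "(k + 1) * k = k * (k - 1) + k * 2" by (simp add: algebra_simps)
  then show ?thesis by simp
qed

lemma upper_factor_Suc:
  assumes "x \<noteq> 0" shows "upper_factor x (k + 1) = (1 - x * q powi k) * upper_factor x k"
proof -
  have "qpoch_inf q (q powi (- k) / x) = (1 - q powi (- k) / x) * qpoch_inf q (q powi (1 - k) / x)"
    using qpoch_inf_rec[of "q powi (- k) / x"] by (simp add: power_int_diff power_int_minus field_simps)
  moreover have "(- x) powi (k + 1) = (- x) powi k * (- x)"
    using assms by (simp add: power_int_add_1)
  moreover have "q powi ((k + 1) * k div 2) = q powi (k * (k - 1) div 2) * q powi k"
    by (simp add: triangle_Suc power_int_add)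
  ultimately have "upper_factor x (k + 1) = ((- x) powi k * (- x)) * (q powi (k * (k - 1) div 2) * q powi k) *
      ((1 - q powi (- k) / x) * qpoch_inf q (q powi (1 - k) / x))"
    unfolding upper_factor_def by simp
  also have "\<dots> = ((1 - q powi (- k) / x) * ((- x) * q powi k)) * upper_factor x k"
    unfolding upper_factor_def by (simp only: mult_ac)
  also have "(1 - q powi (- k) / x) * ((- x) * q powi k) = 1 - x * q powi k"
    using assms by (simp add: power_int_minus field_simps)
  finally show ?thesis .
qed

lemma lower_factor_Suc: "lower_factor y k = (1 - q powi (k + 1) * y) * lower_factor y (k + 1)"
proof -
  have e: "q powi (k + 1 + 1) = q * q powi (k + 1)"
    by (rule power_int_add_1') simp
  show ?thesis
    unfolding lower_factor_def e using qpoch_inf_rec[of "q powi (k + 1) * y"] by (simp only: mult.assoc)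
qed

lemma upper_factor_shift:
  assumes "x \<noteq> 0" shows "upper_factor (q * x) k = - upper_factor x (k + 1) / x"
proof -
  have "(- (q * x)) powi k = (- x) powi k * q powi k"
    by (metis mult.commute mult_minus_right power_int_mult_distrib)
  moreover have "(- x) powi (k + 1) = (- x) powi k * (- x)"
    using assms by (simp add: power_int_add_1)
  moreover have "q powi ((k + 1) * k div 2) = q powi (k * (k - 1) div 2) * q powi k"
    by (simp add: triangle_Suc power_int_add)
  moreover have "q powi (1 - k) / (q * x) = q powi (- k) / x"
    by (simp add: power_int_diff power_int_minus field_simps)
  ultimately show ?thesis
    unfolding upper_factor_def using assms by simp
qed

lemma lower_factor_shift: "lower_factor (q * y) k = lower_factor y (k + 1)"
proof -
  have e: "q powi (k + 1 + 1) = q * q powi (k + 1)"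
    by (rule power_int_add_1') simp
  show ?thesis unfolding lower_factor_def e by (simp only: mult_ac)
qed

lemma upper_factor_of_nat:
  assumes "x \<noteq> 0" shows "upper_factor x (int n) = qpoch_inf q (q / x) * (\<Prod>j<n. 1 - x * q ^ j)"
proof (induction n)
  case 0
  then show ?case by (simp add: upper_factor_def)
next
  case (Suc n)
  have "upper_factor x (int (Suc n)) = upper_factor x (int n + 1)" by (simp add: add.commute)
  then show ?case using Suc upper_factor_Suc[OF assms, of "int n"] by simp
qed

text \<open>
  Inverting the parameters exchanges the two kinds of factors and reverses the summation. All
  estimates for \<open>k \<rightarrow> -\<infinity>\<close> are reduced by it to those for \<open>k \<rightarrow> \<infinity>\<close>.
\<close>

lemma upper_factor_lower_factor_reflect:
  assumes "x \<noteq> 0" "y \<noteq> 0"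
  shows "upper_factor x (- m) * lower_factor y (- m) = (q * y / x) powi m * (upper_factor (1 / y) m * lower_factor (1 / x) m)"
proof -
  have 1: "upper_factor x (- m) = (- x) powi (- m) * q powi ((m + 1) * m div 2) * lower_factor (1 / x) m"
  proof -
    have "(- m) * (- m - 1) = (m + 1) * m" by (simp add: algebra_simps)
    then show ?thesis unfolding upper_factor_def lower_factor_def by (simp add: add.commute)
  qed
  have 2: "upper_factor (1 / y) m = (- 1 / y) powi m * q powi (m * (m - 1) div 2) * lower_factor y (- m)"
    unfolding upper_factor_def lower_factor_def by simp
  have 3: "(q * y / x) powi m * (- 1 / y) powi m = (- x) powi (- m) * q powi m"
  proof -
    have "(q * y / x) powi m * (- 1 / y) powi m = ((q * y / x) * (- 1 / y)) powi m"
      by (rule power_int_mult_distrib[symmetric])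
    also have "(q * y / x) * (- 1 / y) = inverse (- x) * q"
      using assms by (simp add: field_simps)
    also have "(inverse (- x) * q) powi m = (- x) powi (- m) * q powi m"
      by (simp only: power_int_mult_distrib power_int_inverse power_int_minus)
    finally show ?thesis .
  qed
  have "(q * y / x) powi m * (upper_factor (1 / y) m * lower_factor (1 / x) m) =
      ((q * y / x) powi m * (- 1 / y) powi m) * q powi (m * (m - 1) div 2) * lower_factor y (- m) * lower_factor (1 / x) m"
    unfolding 2 by (simp only: mult_ac)
  also have "\<dots> = (- x) powi (- m) * (q powi (m * (m - 1) div 2) * q powi m) * lower_factor (1 / x) m * lower_factor y (- m)"
    unfolding 3 by (simp only: mult_ac)
  also have "q powi (m * (m - 1) div 2) * q powi m = q powi ((m + 1) * m div 2)"
    by (simp add: triangle_Suc power_int_add)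
  finally show ?thesis unfolding 1 by (simp only: mult_ac)
qed

definition factor_bound :: "complex \<Rightarrow> real" where
  "factor_bound x = exp ((cmod x + 1 / cmod x) / (1 - cmod q))"

lemma factor_bound_inverse: "factor_bound (1 / x) = factor_bound x"
  by (simp add: factor_bound_def norm_divide add.commute)

lemma factor_bound_nonneg: "0 \<le> factor_bound x" by (simp add: factor_bound_def)

lemma norm_upper_factor_le:
  assumes "x \<noteq> 0" shows "cmod (upper_factor x (int n)) \<le> factor_bound x"
proof -
  have "cmod (upper_factor x (int n)) \<le> exp (cmod (q / x) / (1 - cmod q)) * exp (cmod x / (1 - cmod q))"
    unfolding upper_factor_of_nat[OF assms] norm_mult
    by (intro mult_mono norm_qpoch_inf_le norm_qprod_le) auto
  also have "\<dots> \<le> exp (1 / cmod x / (1 - cmod q)) * exp (cmod x / (1 - cmod q))"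
  proof -
    have "cmod (q / x) \<le> 1 / cmod x"
      using norm_q by (simp add: norm_divide divide_right_mono)
    then have "cmod (q / x) / (1 - cmod q) \<le> 1 / cmod x / (1 - cmod q)"
      using norm_q by (intro divide_right_mono) auto
    then show ?thesis by simp
  qed
  also have "\<dots> = factor_bound x"
    by (simp add: factor_bound_def add_divide_distrib exp_add)
  finally show ?thesis .
qed

lemma norm_lower_factor_le: "cmod (lower_factor y (int n)) \<le> factor_bound y"
proof -
  have "cmod (q powi (int n + 1)) \<le> 1"
    using norm_q power_le_one[of "cmod q" "Suc n"]
    by (simp add: norm_power_int power_int_add_1 norm_mult norm_power mult.commute)
  then have "cmod (q powi (int n + 1) * y) \<le> cmod y"
    by (simp add: norm_mult mult_left_le_one_le)
  also have "\<dots> \<le> cmod y + 1 / cmod y" by simp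
  finally have "exp (cmod (q powi (int n + 1) * y) / (1 - cmod q)) \<le> factor_bound y"
    unfolding factor_bound_def using norm_q by (simp add: divide_right_mono)
  then show ?thesis
    unfolding lower_factor_def using norm_qpoch_inf_le order_trans by blast
qed

text \<open>
  With \<open>X\<^sub>j = a\<^sub>j x\<close> and \<open>Y\<^sub>j = x / b\<^sub>j\<close> this is the term of \<open>f3 q a b x\<close>, prefactor included. The balancing
  condition becomes \<open>X\<^sub>1 X\<^sub>2 X\<^sub>3 = q Y\<^sub>1 Y\<^sub>2 Y\<^sub>3\<close>. Keeping the \<open>X\<^sub>j\<close> and \<open>Y\<^sub>j\<close> as independent variables allows the sum
  to be used as a holomorphic function of \<open>x\<close> and of the parameters alike.
\<close>

definition bilateral_term where
  "bilateral_term X1 X2 X3 Y1 Y2 Y3 k =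
     q powi k * (upper_factor X1 k * lower_factor Y1 k) * (upper_factor X2 k * lower_factor Y2 k) * (upper_factor X3 k * lower_factor Y3 k)"

definition bilateral_sum where
  "bilateral_sum X1 X2 X3 Y1 Y2 Y3 = infsum (bilateral_term X1 X2 X3 Y1 Y2 Y3) UNIV"

text \<open>
  The reflection produces \<open>(q\<^sup>3 Y\<^sub>1 Y\<^sub>2 Y\<^sub>3 / X\<^sub>1 X\<^sub>2 X\<^sub>3)\<^sup>m\<close>, which the balancing condition turns into \<open>q\<^sup>2\<^sup>m\<close>;
  together with \<open>q\<^sup>-\<^sup>m\<close> this is the power \<open>q\<^sup>m\<close> required.
\<close>

lemma bilateral_term_reflect:
  assumes "X1 \<noteq> 0" "X2 \<noteq> 0" "X3 \<noteq> 0" "Y1 \<noteq> 0" "Y2 \<noteq> 0" "Y3 \<noteq> 0"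
    and bal: "X1 * X2 * X3 = q * (Y1 * Y2 * Y3)"
  shows "bilateral_term X1 X2 X3 Y1 Y2 Y3 (- m) = bilateral_term (1/Y1) (1/Y2) (1/Y3) (1/X1) (1/X2) (1/X3) m"
proof -
  have "(q * Y1 / X1) powi m * (q * Y2 / X2) powi m * (q * Y3 / X3) powi m =
      ((q * Y1 / X1) * (q * Y2 / X2) * (q * Y3 / X3)) powi m"
    by (simp only: power_int_mult_distrib)
  also have "(q * Y1 / X1) * (q * Y2 / X2) * (q * Y3 / X3) = q ^ 3 * (Y1 * Y2 * Y3) / (X1 * X2 * X3)"
    by (simp add: power3_eq_cube)
  also have "\<dots> = q ^ 2"
    unfolding bal using assms by (simp add: power3_eq_cube power2_eq_square)
  finally have eq: "(q * Y1 / X1) powi m * (q * Y2 / X2) powi m * (q * Y3 / X3) powi m = q powi m * q powi m"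
    by (simp add: power2_eq_square power_int_mult_distrib)
  have "bilateral_term X1 X2 X3 Y1 Y2 Y3 (- m) =
     q powi (- m) * ((q * Y1 / X1) powi m * (q * Y2 / X2) powi m * (q * Y3 / X3) powi m) *
       (upper_factor (1 / Y1) m * lower_factor (1 / X1) m) * (upper_factor (1 / Y2) m * lower_factor (1 / X2) m) * (upper_factor (1 / Y3) m * lower_factor (1 / X3) m)"
    unfolding bilateral_term_def upper_factor_lower_factor_reflect[OF assms(1,4)] upper_factor_lower_factor_reflect[OF assms(2,5)]
      upper_factor_lower_factor_reflect[OF assms(3,6)] by (simp only: mult_ac)
  also have "q powi (- m) * ((q * Y1 / X1) powi m * (q * Y2 / X2) powi m * (q * Y3 / X3) powi m) = q powi m"
    unfolding eq by (simp add: power_int_minus)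
  finally show ?thesis unfolding bilateral_term_def .
qed

definition term_bound where
  "term_bound X1 X2 X3 Y1 Y2 Y3 =
     (factor_bound X1 * factor_bound Y1) * (factor_bound X2 * factor_bound Y2) * (factor_bound X3 * factor_bound Y3)"

lemma norm_bilateral_term_le:
  assumes nz: "X1 \<noteq> 0" "X2 \<noteq> 0" "X3 \<noteq> 0" "Y1 \<noteq> 0" "Y2 \<noteq> 0" "Y3 \<noteq> 0"
    and bal: "X1 * X2 * X3 = q * (Y1 * Y2 * Y3)"
  shows "cmod (bilateral_term X1 X2 X3 Y1 Y2 Y3 k) \<le> term_bound X1 X2 X3 Y1 Y2 Y3 * cmod q ^ nat \<bar>k\<bar>"
proof -
  have nonneg: "cmod (bilateral_term X1 X2 X3 Y1 Y2 Y3 (int n)) \<le> term_bound X1 X2 X3 Y1 Y2 Y3 * cmod q ^ n"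
    if nz: "X1 \<noteq> 0" "X2 \<noteq> 0" "X3 \<noteq> 0" for X1 X2 X3 Y1 Y2 Y3 n
  proof -
    have "cmod (bilateral_term X1 X2 X3 Y1 Y2 Y3 (int n)) = cmod q ^ n *
        ((cmod (upper_factor X1 (int n)) * cmod (lower_factor Y1 (int n))) * (cmod (upper_factor X2 (int n)) * cmod (lower_factor Y2 (int n))) *
        (cmod (upper_factor X3 (int n)) * cmod (lower_factor Y3 (int n))))"
      unfolding bilateral_term_def by (simp add: norm_mult norm_power)
    also have "\<dots> \<le> cmod q ^ n * term_bound X1 X2 X3 Y1 Y2 Y3"
      unfolding term_bound_def
      by (intro mult_left_mono mult_mono norm_upper_factor_le norm_lower_factor_le nz mult_nonneg_nonneg factor_bound_nonneg) auto
    finally show ?thesis by (simp add: mult.commute)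
  qed
  show ?thesis
  proof (cases "k \<ge> 0")
    case True
    then show ?thesis using nonneg[OF nz(1-3), of Y1 Y2 Y3 "nat k"] by simp
  next
    case False
    define n where "n = nat (- k)"
    have k: "k = - int n" using False by (simp add: n_def)
    have "term_bound (1/Y1) (1/Y2) (1/Y3) (1/X1) (1/X2) (1/X3) = term_bound X1 X2 X3 Y1 Y2 Y3"
      unfolding term_bound_def factor_bound_inverse by (simp only: mult_ac)
    then show ?thesis
      using nonneg[of "1/Y1" "1/Y2" "1/Y3" "1/X1" "1/X2" "1/X3" n] nz
      unfolding k bilateral_term_reflect[OF nz bal] by simp
  qed
qed

lemma bilateral_term_shift:
  assumes "X1 \<noteq> 0" "X2 \<noteq> 0" "X3 \<noteq> 0"
  shows "bilateral_term (q*X1) (q*X2) (q*X3) (q*Y1) (q*Y2) (q*Y3) k =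
    - 1 / (q * (X1 * X2 * X3)) * bilateral_term X1 X2 X3 Y1 Y2 Y3 (k + 1)"
  unfolding bilateral_term_def upper_factor_shift[OF assms(1)] upper_factor_shift[OF assms(2)] upper_factor_shift[OF assms(3)] lower_factor_shift
  using assms by (simp add: power_int_add field_simps)

lemma bilateral_sum_shift:
  assumes "X1 \<noteq> 0" "X2 \<noteq> 0" "X3 \<noteq> 0"
  shows "bilateral_sum (q*X1) (q*X2) (q*X3) (q*Y1) (q*Y2) (q*Y3) =
    - 1 / (q * (X1 * X2 * X3)) * bilateral_sum X1 X2 X3 Y1 Y2 Y3"
proof -
  have "bij_betw (\<lambda>k. k + 1) (UNIV :: int set) UNIV"
    by (rule bij_betwI[where g = "\<lambda>k. k - 1"]) auto
  then have "infsum (\<lambda>k. bilateral_term X1 X2 X3 Y1 Y2 Y3 (k + 1)) UNIV = bilateral_sum X1 X2 X3 Y1 Y2 Y3"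
    unfolding bilateral_sum_def by (rule infsum_reindex_bij_betw)
  moreover have "bilateral_term (q*X1) (q*X2) (q*X3) (q*Y1) (q*Y2) (q*Y3) =
      (\<lambda>k. - 1 / (q * (X1 * X2 * X3)) * bilateral_term X1 X2 X3 Y1 Y2 Y3 (k + 1))"
    by (rule ext) (rule bilateral_term_shift[OF assms])
  ultimately show ?thesis
    unfolding bilateral_sum_def[of "q * X1"] by (simp only: infsum_cmult_right')
qed

lemma holomorphic_upper_factor [holomorphic_intros]:
  "f holomorphic_on A \<Longrightarrow> (\<And>z. z \<in> A \<Longrightarrow> f z \<noteq> 0) \<Longrightarrow> (\<lambda>z. upper_factor (f z) k) holomorphic_on A"
  unfolding upper_factor_def by (intro holomorphic_intros) auto

lemma holomorphic_lower_factor [holomorphic_intros]: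
  "f holomorphic_on A \<Longrightarrow> (\<lambda>z. lower_factor (f z) k) holomorphic_on A"
  unfolding lower_factor_def by (intro holomorphic_intros)

lemma continuous_on_factor_bound:
  "f holomorphic_on A \<Longrightarrow> (\<And>z. z \<in> A \<Longrightarrow> f z \<noteq> 0) \<Longrightarrow> continuous_on A (\<lambda>z. factor_bound (f z))"
  unfolding factor_bound_def using norm_q
  by (intro continuous_intros holomorphic_on_imp_continuous_on) auto

lemma holomorphic_bilateral_sum:
  assumes S: "open S"
    and hol: "X1 holomorphic_on S" "X2 holomorphic_on S" "X3 holomorphic_on S"
      "Y1 holomorphic_on S" "Y2 holomorphic_on S" "Y3 holomorphic_on S"
    and nz: "\<And>z. z \<in> S \<Longrightarrow> X1 z \<noteq> 0" "\<And>z. z \<in> S \<Longrightarrow> X2 z \<noteq> 0" "\<And>z. z \<in> S \<Longrightarrow> X3 z \<noteq> 0"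
      "\<And>z. z \<in> S \<Longrightarrow> Y1 z \<noteq> 0" "\<And>z. z \<in> S \<Longrightarrow> Y2 z \<noteq> 0" "\<And>z. z \<in> S \<Longrightarrow> Y3 z \<noteq> 0"
    and bal: "\<And>z. z \<in> S \<Longrightarrow> X1 z * X2 z * X3 z = q * (Y1 z * Y2 z * Y3 z)"
  shows "(\<lambda>z. bilateral_sum (X1 z) (X2 z) (X3 z) (Y1 z) (Y2 z) (Y3 z)) holomorphic_on S"
  unfolding bilateral_sum_def
proof (rule holomorphic_bilateral_series[OF S])
  show "(\<lambda>z. bilateral_term (X1 z) (X2 z) (X3 z) (Y1 z) (Y2 z) (Y3 z) k) holomorphic_on S" for k
    unfolding bilateral_term_def by (intro holomorphic_intros hol nz) auto
  show "cmod (bilateral_term (X1 z) (X2 z) (X3 z) (Y1 z) (Y2 z) (Y3 z) k)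
      \<le> term_bound (X1 z) (X2 z) (X3 z) (Y1 z) (Y2 z) (Y3 z) * cmod q ^ nat \<bar>k\<bar>" if "z \<in> S" for k z
    by (intro norm_bilateral_term_le nz bal that)
  show "continuous_on S (\<lambda>z. term_bound (X1 z) (X2 z) (X3 z) (Y1 z) (Y2 z) (Y3 z))"
    unfolding term_bound_def by (intro continuous_intros continuous_on_factor_bound hol nz)
qed (use norm_q in auto)

end

section \<open>The contiguous relation\<close>

definition det3 :: "('a \<Rightarrow> complex) \<Rightarrow> ('a \<Rightarrow> complex) \<Rightarrow> ('a \<Rightarrow> complex) \<Rightarrow> 'a \<Rightarrow> 'a \<Rightarrow> 'a \<Rightarrow> complex" where
  "det3 f g h x y z =
     f x * g y * h z + g x * h y * f z + h x * f y * g z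
     - f x * h y * g z - g x * f y * h z - h x * g y * f z"

lemma det3_column_operations:
  assumes g: "\<And>x. x \<in> {x1, x2, x3} \<Longrightarrow> c * g' x = d * g x"
    and h: "\<And>x. x \<in> {x1, x2, x3} \<Longrightarrow> e * h' x = k * h x + \<alpha> * g x + \<beta> * f x"
  shows "c * e * det3 f g' h' x1 x2 x3 = d * k * det3 f g h x1 x2 x3"
proof -
  have "c * e * det3 f g' h' x1 x2 x3 = det3 f (\<lambda>x. c * g' x) (\<lambda>x. e * h' x) x1 x2 x3"
    by (simp add: det3_def algebra_simps)
  also have "\<dots> = det3 f (\<lambda>x. d * g x) (\<lambda>x. k * h x + \<alpha> * g x + \<beta> * f x) x1 x2 x3"
    using g h by (simp add: det3_def)
  also have "\<dots> = d * k * det3 f g h x1 x2 x3"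
    by (simp add: det3_def algebra_simps)
  finally show ?thesis .
qed

context q_base
begin

definition F1 where
  "F1 b1 b2 b3 x = x * (qtheta q (b1 / x) * qtheta q (b2 / x) * qtheta q (b3 / x))"

definition F2 where
  "F2 a1 a2 a3 x = inverse x * (qtheta q (a1 * x) * qtheta q (a2 * x) * qtheta q (a3 * x))"

definition F3 where
  "F3 a1 a2 a3 b1 b2 b3 x = bilateral_sum (a1 * x) (a2 * x) (a3 * x) (x / b1) (x / b2) (x / b3)"

lemma upper_factor_LIMSEQ: "x \<noteq> 0 \<Longrightarrow> (\<lambda>n. upper_factor x (int n)) \<longlonglongrightarrow> qtheta q x"
  unfolding upper_factor_of_nat qtheta_def
  by (subst mult.commute) (intro tendsto_mult tendsto_const qpoch_inf_LIMSEQ)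

lemma lower_factor_LIMSEQ: "(\<lambda>n. lower_factor y (int n + c)) \<longlonglongrightarrow> 1"
  unfolding lower_factor_def
proof (rule qpoch_inf_tendsto_1)
  have "(\<lambda>n. q ^ n) \<longlonglongrightarrow> 0" using norm_q by (intro LIMSEQ_power_zero) auto
  then have "(\<lambda>n. q ^ n * (q powi (c + 1) * y)) \<longlonglongrightarrow> 0" by (rule tendsto_mult_left_zero)
  moreover have "q powi (int n + c + 1) * y = q ^ n * (q powi (c + 1) * y)" for n
    by (simp add: power_int_add mult_ac)
  ultimately show "(\<lambda>n. q powi (int n + c + 1) * y) \<longlonglongrightarrow> 0" by (simp only:)
qed

text \<open>
  The two cubics have the same constant and the same leading coefficient, so their difference is \<open>x\<close>
  times a linear polynomial. The right-hand side interpolates the latter at \<open>1 / u\<close> and \<open>1 / v\<close>,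
  where the first cubic vanishes.
\<close>

lemma cubic_identity:
  fixes u v w x \<beta>1 \<beta>2 \<beta>3 :: complex
  assumes "u * v * w = \<beta>1 * \<beta>2 * \<beta>3"
  shows "(u - v) * (u * v) * ((1 - u * x) * (1 - v * x) * (1 - w * x) -
      (1 - \<beta>1 * x) * (1 - \<beta>2 * x) * (1 - \<beta>3 * x)) =
    x * ((v - \<beta>1) * (v - \<beta>2) * (v - \<beta>3) * u * (1 - u * x) -
      (u - \<beta>1) * (u - \<beta>2) * (u - \<beta>3) * v * (1 - v * x))"
  using assms by algebra

text \<open>
  The terms for \<open>(u, q v, w)\<close> and for \<open>(q u, v, w)\<close> are, up to constants, \<open>1 - v y\<close> and \<open>1 - u y\<close> times
  the term for \<open>(u, v, w)\<close>, where \<open>y = x q\<^sup>k\<close>. By the cubic identity, a suitable combination of them is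
  the difference of consecutive values of a multiple of
  \<open>\<Prod>\<^sub>j upper_factor (a\<^sub>j x) k * lower_factor (x / b\<^sub>j) (k - 1)\<close> with \<open>(a\<^sub>1, a\<^sub>2, a\<^sub>3) = (u, v, w)\<close>. As \<open>k \<rightarrow> \<infinity>\<close>
  this product tends to \<open>\<theta>(u x) \<theta>(v x) \<theta>(w x)\<close>, a multiple of \<open>F2\<close>; by reflection, its limit for
  \<open>k \<rightarrow> -\<infinity>\<close> is a multiple of \<open>F1\<close>.
\<close>

lemma F3_contiguous:
  assumes nz: "u \<noteq> 0" "v \<noteq> 0" "w \<noteq> 0" "b1 \<noteq> 0" "b2 \<noteq> 0" "b3 \<noteq> 0" "x \<noteq> 0"
    and bal: "u * v * w * (b1 * b2 * b3) = 1"
  shows "(u - 1/b1) * (u - 1/b2) * (u - 1/b3) * v\<^sup>2 * F3 u (q * v) w b1 b2 b3 x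
      - (v - 1/b1) * (v - 1/b2) * (v - 1/b3) * u\<^sup>2 * F3 (q * u) v w b1 b2 b3 x
    = (u - v) * (u * v) * (F1 b1 b2 b3 x / (b1 * b2 * b3) - v * F2 u (q * v) w x)"
proof -
  define A where "A = (u - 1/b1) * (u - 1/b2) * (u - 1/b3)"
  define B where "B = (v - 1/b1) * (v - 1/b2) * (v - 1/b3)"
  define \<Phi> where "\<Phi> = (\<lambda>k. upper_factor (u * x) k * upper_factor (v * x) k * upper_factor (w * x) k)"
  define \<Psi> where "\<Psi> = (\<lambda>k. lower_factor (x / b1) k * lower_factor (x / b2) k * lower_factor (x / b3) k)"
  define T where "T = bilateral_term (u * x) (q * v * x) (w * x) (x / b1) (x / b2) (x / b3)"
  define T' where "T' = bilateral_term (q * u * x) (v * x) (w * x) (x / b1) (x / b2) (x / b3)"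
  define G where "G = (\<lambda>k. (u - v) * (u * v) * (\<Phi> k * \<Psi> (k - 1) / x))"
  define f where "f = (\<lambda>k. x * (A * v\<^sup>2 * T k - B * u\<^sup>2 * T' k))"
  have T: "T k = - (1 - v * (x * q powi k)) / (v * x) * (q powi k * \<Phi> k * \<Psi> k)" for k
  proof -
    have "upper_factor (q * v * x) k = - (1 - v * x * q powi k) * upper_factor (v * x) k / (v * x)"
      using upper_factor_shift[of "v * x" k] upper_factor_Suc[of "v * x" k] nz
      by (simp only: mult_minus_left mult.assoc[symmetric] mult_eq_0_iff simp_thms)
    then show ?thesis
      unfolding T_def bilateral_term_def \<Phi>_def \<Psi>_def by (simp add: mult_ac)
  qed
  have T': "T' k = - (1 - u * (x * q powi k)) / (u * x) * (q powi k * \<Phi> k * \<Psi> k)" for k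
  proof -
    have "upper_factor (q * u * x) k = - (1 - u * x * q powi k) * upper_factor (u * x) k / (u * x)"
      using upper_factor_shift[of "u * x" k] upper_factor_Suc[of "u * x" k] nz
      by (simp only: mult_minus_left mult.assoc[symmetric] mult_eq_0_iff simp_thms)
    then show ?thesis
      unfolding T'_def bilateral_term_def \<Phi>_def \<Psi>_def by (simp add: mult_ac)
  qed
  have step: "f k = G (k + 1) - G k" for k
  proof -
    let ?y = "x * q powi k"
    have e1: "\<Phi> (k + 1) = (1 - u * ?y) * (1 - v * ?y) * (1 - w * ?y) * \<Phi> k"
      using nz upper_factor_Suc[of "u * x" k] upper_factor_Suc[of "v * x" k] upper_factor_Suc[of "w * x" k]
      by (simp add: \<Phi>_def mult_ac)
    have e2: "\<Psi> (k - 1) = (1 - 1/b1 * ?y) * (1 - 1/b2 * ?y) * (1 - 1/b3 * ?y) * \<Psi> k"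
      using lower_factor_Suc[of "x / b1" "k - 1"] lower_factor_Suc[of "x / b2" "k - 1"] lower_factor_Suc[of "x / b3" "k - 1"]
      by (simp add: \<Psi>_def mult_ac)
    have factor: "c * (P1 * F * S / x) - c * (F * (P2 * S) / x) = c * (P1 - P2) * (F * S / x)"
      for c P1 P2 F S :: complex
      by (simp add: algebra_simps diff_divide_distrib)
    have "G (k + 1) - G k = (u - v) * (u * v) *
        ((1 - u * ?y) * (1 - v * ?y) * (1 - w * ?y) -
         (1 - 1/b1 * ?y) * (1 - 1/b2 * ?y) * (1 - 1/b3 * ?y)) * (\<Phi> k * \<Psi> k / x)"
      unfolding G_def e1 e2 add_diff_cancel_right' by (rule factor)
    also have "\<dots> = ?y * (B * u * (1 - u * ?y) - A * v * (1 - v * ?y)) * (\<Phi> k * \<Psi> k / x)"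
    proof (subst cubic_identity)
      show "u * v * w = 1/b1 * (1/b2) * (1/b3)" using bal nz by (simp add: field_simps)
    qed (simp add: A_def B_def)
    also have "\<dots> = q powi k * \<Phi> k * \<Psi> k * (B * u * (1 - u * ?y) - A * v * (1 - v * ?y))"
      using nz by simp
    also have "\<dots> = f k"
    proof -
      have cancel: "c\<^sup>2 * x * (- r / (c * x) * s) = - c * r * s" if "c \<noteq> 0" for c r s :: complex
        using that nz by (simp add: power2_eq_square)
      have "v\<^sup>2 * x * T k = - v * (1 - v * ?y) * (q powi k * \<Phi> k * \<Psi> k)"
        unfolding T by (rule cancel) (use nz in simp)
      moreover have "u\<^sup>2 * x * T' k = - u * (1 - u * ?y) * (q powi k * \<Phi> k * \<Psi> k)"
        unfolding T' by (rule cancel) (use nz in simp)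
      moreover have "f k = A * (v\<^sup>2 * x * T k) - B * (u\<^sup>2 * x * T' k)"
        by (simp add: f_def algebra_simps)
      ultimately show ?thesis by (simp only:) (simp add: algebra_simps)
    qed
    finally show ?thesis by simp
  qed
  have bal': "u * x * (v * x) * (w * x) = x / b1 * (x / b2) * (x / b3)"
    using bal nz by (simp add: field_simps)
  have balT: "u * x * (q * v * x) * (w * x) = q * (x / b1 * (x / b2) * (x / b3))"
    and balT': "q * u * x * (v * x) * (w * x) = q * (x / b1 * (x / b2) * (x / b3))"
    unfolding bal'[symmetric] by simp_all
  define W where "W = term_bound (u * x) (q * v * x) (w * x) (x / b1) (x / b2) (x / b3)"
  define W' where "W' = term_bound (q * u * x) (v * x) (w * x) (x / b1) (x / b2) (x / b3)"
  have nT: "cmod (T k) \<le> W * cmod q ^ nat \<bar>k\<bar>" for k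
    unfolding T_def W_def by (rule norm_bilateral_term_le[OF _ _ _ _ _ _ balT]) (use nz in auto)
  have nT': "cmod (T' k) \<le> W' * cmod q ^ nat \<bar>k\<bar>" for k
    unfolding T'_def W'_def by (rule norm_bilateral_term_le[OF _ _ _ _ _ _ balT']) (use nz in auto)
  have bound: "cmod (f k) \<le> cmod x * (cmod (A * v\<^sup>2) * W + cmod (B * u\<^sup>2) * W') * cmod q ^ nat \<bar>k\<bar>" for k
  proof -
    have "cmod (f k) \<le> cmod x * (cmod (A * v\<^sup>2 * T k) + cmod (B * u\<^sup>2 * T' k))"
      unfolding f_def norm_mult[of x] by (intro mult_left_mono norm_triangle_ineq4) auto
    also have "\<dots> \<le> cmod x * (cmod (A * v\<^sup>2) * (W * cmod q ^ nat \<bar>k\<bar>) + cmod (B * u\<^sup>2) * (W' * cmod q ^ nat \<bar>k\<bar>))"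
      unfolding norm_mult[of "A * v\<^sup>2" "T k"] norm_mult[of "B * u\<^sup>2" "T' k"]
      by (intro mult_left_mono add_mono nT nT') auto
    finally show ?thesis by (simp add: algebra_simps)
  qed
  have lim1: "(\<lambda>n. G (int n)) \<longlonglongrightarrow> (u - v) * (u * v) *
      (qtheta q (u * x) * qtheta q (v * x) * qtheta q (w * x) * (1 * 1 * 1) / x)"
    unfolding G_def \<Phi>_def \<Psi>_def diff_conv_add_uminus[of "int _" 1]
    by (intro tendsto_intros upper_factor_LIMSEQ lower_factor_LIMSEQ) (use nz in auto)
  \<comment> \<open>The powers produced by the reflection cancel since \<open>u v w b\<^sub>1 b\<^sub>2 b\<^sub>3 = 1\<close>.\<close>
  have G_neg: "G (- int n) = (u - v) * (u * v) *
      ((upper_factor (q * b1 / x) (int n) * upper_factor (q * b2 / x) (int n) * upper_factor (q * b3 / x) (int n)) *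
       (lower_factor (1 / (u * x)) (int n + 0) * lower_factor (1 / (v * x)) (int n + 0) * lower_factor (1 / (w * x)) (int n + 0)) / x)" for n
  proof -
    have 1: "upper_factor (c * x) (- int n) * lower_factor (x / b) (- int n - 1) =
        (1 / (c * b)) powi (int n) * (upper_factor (q * b / x) (int n) * lower_factor (1 / (c * x)) (int n))"
      if "c \<noteq> 0" "b \<noteq> 0" for c b
    proof -
      have "lower_factor (x / b) (- int n - 1) = lower_factor (x / b / q) (- int n)"
        using lower_factor_shift[of "x / b / q" "- int n - 1"] by simp
      then show ?thesis
        using upper_factor_lower_factor_reflect[of "c * x" "x / b / q" "int n"] that nz by (simp add: field_simps)
    qed
    have "(1 / (u * b1)) powi (int n) * (1 / (v * b2)) powi (int n) * (1 / (w * b3)) powi (int n) =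
        (1 / (u * b1) * (1 / (v * b2)) * (1 / (w * b3))) powi (int n)"
      by (simp only: power_int_mult_distrib)
    also have "1 / (u * b1) * (1 / (v * b2)) * (1 / (w * b3)) = 1"
      using bal nz by (simp add: field_simps)
    finally have 2: "(1 / (u * b1)) powi (int n) * (1 / (v * b2)) powi (int n) * (1 / (w * b3)) powi (int n) = 1"
      by simp
    have "\<Phi> (- int n) * \<Psi> (- int n - 1) =
        (upper_factor (u * x) (- int n) * lower_factor (x / b1) (- int n - 1)) *
        (upper_factor (v * x) (- int n) * lower_factor (x / b2) (- int n - 1)) *
        (upper_factor (w * x) (- int n) * lower_factor (x / b3) (- int n - 1))"
      unfolding \<Phi>_def \<Psi>_def by (simp only: mult_ac)
    also have "\<dots> = ((1 / (u * b1)) powi (int n) * (1 / (v * b2)) powi (int n) * (1 / (w * b3)) powi (int n)) *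
      (upper_factor (q * b1 / x) (int n) * upper_factor (q * b2 / x) (int n) * upper_factor (q * b3 / x) (int n)) *
      (lower_factor (1 / (u * x)) (int n) * lower_factor (1 / (v * x)) (int n) * lower_factor (1 / (w * x)) (int n))"
      unfolding 1[OF nz(1,4)] 1[OF nz(2,5)] 1[OF nz(3,6)] by (simp only: mult_ac)
    finally show ?thesis unfolding G_def 2 by simp
  qed
  have lim2: "(\<lambda>n. G (- int n)) \<longlonglongrightarrow> (u - v) * (u * v) *
      ((qtheta q (q * b1 / x) * qtheta q (q * b2 / x) * qtheta q (q * b3 / x)) * (1 * 1 * 1) / x)"
    unfolding G_neg by (intro tendsto_intros upper_factor_LIMSEQ lower_factor_LIMSEQ) (use nz in auto)
  have sT: "T summable_on UNIV" "T' summable_on UNIV"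
    using bilateral_summable[OF nT] bilateral_summable[OF nT'] norm_q by auto
  have "infsum f UNIV = x * infsum (\<lambda>k. A * v\<^sup>2 * T k + (- (B * u\<^sup>2)) * T' k) UNIV"
    unfolding f_def infsum_cmult_right'[symmetric] by simp
  also have "\<dots> = x * (A * v\<^sup>2 * infsum T UNIV + (- (B * u\<^sup>2)) * infsum T' UNIV)"
    by (subst infsum_add[OF summable_on_cmult_right[OF sT(1)] summable_on_cmult_right[OF sT(2)]])
       (simp only: infsum_cmult_right')
  finally have "x * (A * v\<^sup>2 * infsum T UNIV - B * u\<^sup>2 * infsum T' UNIV) = infsum f UNIV"
    by simp
  also have "\<dots> = (u - v) * (u * v) *
      (qtheta q (u * x) * qtheta q (v * x) * qtheta q (w * x) * (1 * 1 * 1) / x) -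
      (u - v) * (u * v) *
      ((qtheta q (q * b1 / x) * qtheta q (q * b2 / x) * qtheta q (q * b3 / x)) * (1 * 1 * 1) / x)"
    by (rule bilateral_telescoping[OF bound _ _ step lim1 lim2]) (use norm_q in auto)
  also have "qtheta q (u * x) * qtheta q (v * x) * qtheta q (w * x) * (1 * 1 * 1) / x = - (v * x * F2 u (q * v) w x)"
    using nz by (simp add: F2_def mult.assoc[of q] qtheta_shift field_simps)
  also have "(qtheta q (q * b1 / x) * qtheta q (q * b2 / x) * qtheta q (q * b3 / x)) * (1 * 1 * 1) / x =
      - (x * F1 b1 b2 b3 x / (b1 * b2 * b3))"
  proof -
    have "qtheta q (q * b / x) = - qtheta q (b / x) * x / b" if "b \<noteq> 0" for b
      using qtheta_shift[of "b / x"] that nz by simp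
    then show ?thesis using nz by (simp add: F1_def mult_ac)
  qed
  finally have "x * (A * v\<^sup>2 * infsum T UNIV - B * u\<^sup>2 * infsum T' UNIV) =
      x * ((u - v) * (u * v) * (F1 b1 b2 b3 x / (b1 * b2 * b3) - v * F2 u (q * v) w x))"
    by (simp add: algebra_simps)
  then have "A * v\<^sup>2 * infsum T UNIV - B * u\<^sup>2 * infsum T' UNIV =
      (u - v) * (u * v) * (F1 b1 b2 b3 x / (b1 * b2 * b3) - v * F2 u (q * v) w x)"
    unfolding mult_cancel_left using nz by simp
  then show ?thesis
    unfolding A_def B_def T_def T'_def F3_def bilateral_sum_def .
qed

definition theta_det where
  "theta_det a1 a2 a3 b1 b2 b3 = det3 (F1 b1 b2 b3) (F2 a1 a2 a3) (F3 a1 a2 a3 b1 b2 b3)"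

text \<open>
  By \<open>F3_contiguous\<close> the third columns are proportional modulo the other two columns, and the second
  columns are proportional because \<open>\<theta>(q y) = - \<theta>(y) / y\<close>.
\<close>

lemma theta_det_contiguous:
  assumes nz: "u \<noteq> 0" "v \<noteq> 0" "w \<noteq> 0" "b1 \<noteq> 0" "b2 \<noteq> 0" "b3 \<noteq> 0"
      "l1 \<noteq> 0" "l2 \<noteq> 0" "l3 \<noteq> 0"
    and bal: "u * v * w * (b1 * b2 * b3) = 1"
  shows "(1 - 1/(v * b1)) * (1 - 1/(v * b2)) * (1 - 1/(v * b3)) * theta_det (q * u) v w b1 b2 b3 l1 l2 l3 =
         (1 - 1/(u * b1)) * (1 - 1/(u * b2)) * (1 - 1/(u * b3)) * theta_det u (q * v) w b1 b2 b3 l1 l2 l3"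
proof -
  define A where "A = (u - 1/b1) * (u - 1/b2) * (u - 1/b3)"
  define B where "B = (v - 1/b1) * (v - 1/b2) * (v - 1/b3)"
  have "u * (B * u\<^sup>2) * theta_det (q * u) v w b1 b2 b3 l1 l2 l3 = v * (A * v\<^sup>2) * theta_det u (q * v) w b1 b2 b3 l1 l2 l3"
    unfolding theta_det_def
  proof (rule det3_column_operations[where \<alpha> = "(u - v) * (u * v) * v"
        and \<beta> = "- (u - v) * (u * v) / (b1 * b2 * b3)"])
    fix x assume "x \<in> {l1, l2, l3}"
    then have x: "x \<noteq> 0" using nz by auto
    show "u * F2 (q * u) v w x = v * F2 u (q * v) w x"
      using nz x by (simp add: F2_def mult.assoc[of q] qtheta_shift field_simps)
    show "B * u\<^sup>2 * F3 (q * u) v w b1 b2 b3 x = A * v\<^sup>2 * F3 u (q * v) w b1 b2 b3 x +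
        (u - v) * (u * v) * v * F2 u (q * v) w x + - (u - v) * (u * v) / (b1 * b2 * b3) * F1 b1 b2 b3 x"
      using F3_contiguous[OF nz(1-6) x bal] unfolding A_def[symmetric] B_def[symmetric]
      by (simp add: algebra_simps diff_divide_distrib)
  qed
  moreover have "A = u ^ 3 * ((1 - 1/(u * b1)) * (1 - 1/(u * b2)) * (1 - 1/(u * b3)))"
    using nz by (simp add: A_def field_simps power3_eq_cube)
  moreover have "B = v ^ 3 * ((1 - 1/(v * b1)) * (1 - 1/(v * b2)) * (1 - 1/(v * b3)))"
    using nz by (simp add: B_def field_simps power3_eq_cube)
  ultimately have "(u ^ 3 * v ^ 3) * ((1 - 1/(v * b1)) * (1 - 1/(v * b2)) * (1 - 1/(v * b3)) * theta_det (q * u) v w b1 b2 b3 l1 l2 l3) =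
      (u ^ 3 * v ^ 3) * ((1 - 1/(u * b1)) * (1 - 1/(u * b2)) * (1 - 1/(u * b3)) * theta_det u (q * v) w b1 b2 b3 l1 l2 l3)"
    by (simp only: power3_eq_cube power2_eq_square mult_ac)
  then show ?thesis unfolding mult_cancel_left using nz by simp
qed

end

context q_base
begin

section \<open>Evaluation for \<open>a\<^sub>1 b\<^sub>1 = 1\<close>\<close>

lemma theta_functionsI:
  assumes "f holomorphic_on -{0}" "\<And>x. x \<noteq> 0 \<Longrightarrow> f (q * x) = c / x ^ n * f x"
  shows "f \<in> theta_functions (int n) c"
  using assms by (simp add: theta_functions_def power_int_minus divide_inverse)

lemma countable_preimage_q_powers:
  assumes "c \<noteq> 0" "d \<noteq> 0"
  shows "countable {x. c / x \<in> q_powers}" "countable {x. x / d \<in> q_powers}"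
proof -
  have "{x. c / x \<in> q_powers} \<subseteq> (\<lambda>y. c / y) ` q_powers"
  proof
    fix x assume "x \<in> {x. c / x \<in> q_powers}"
    moreover have "x = c / (c / x)" using assms by simp
    ultimately show "x \<in> (\<lambda>y. c / y) ` q_powers" by blast
  qed
  then show "countable {x. c / x \<in> q_powers}"
    using countable_q_powers countable_image countable_subset by blast
  have "{x. x / d \<in> q_powers} \<subseteq> (\<lambda>y. y * d) ` q_powers"
  proof
    fix x assume "x \<in> {x. x / d \<in> q_powers}"
    moreover have "x = x / d * d" using assms by simp
    ultimately show "x \<in> (\<lambda>y. y * d) ` q_powers" by blast
  qed
  then show "countable {x. x / d \<in> q_powers}"
    using countable_q_powers countable_image countable_subset by blast
qed

lemma qtheta_shift_left: "a \<noteq> 0 \<Longrightarrow> x \<noteq> 0 \<Longrightarrow> qtheta q (a * (q * x)) = - qtheta q (a * x) / (a * x)"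
  using qtheta_shift[of "a * x"] by (simp add: mult_ac)

lemma qtheta_shift_div: "a \<noteq> 0 \<Longrightarrow> x \<noteq> 0 \<Longrightarrow> qtheta q (q * x / a) = - qtheta q (x / a) * a / x"
  using qtheta_shift[of "x / a"] by (simp add: field_simps)

lemma qtheta_shift_over: "a \<noteq> 0 \<Longrightarrow> x \<noteq> 0 \<Longrightarrow> qtheta q (a / (q * x)) = - (a / (q * x)) * qtheta q (a / x)"
  using qtheta_shift_back[of "a / x"] by (simp add: field_simps)

text \<open>
  As functions of \<open>x\<close>, both sides are theta functions of degree 2 with the same multiplier. They agree
  at \<open>x = y\<close>, where both vanish, and at \<open>x = b\<^sub>2\<close>, where one product on the left vanishes. For
  generic \<open>y\<close> the product of these two zeros of the difference is not the one that the multiplier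
  prescribes.
\<close>

lemma weierstrass_identity:
  assumes nz: "a2 \<noteq> 0" "a3 \<noteq> 0" "b2 \<noteq> 0" "b3 \<noteq> 0" "x \<noteq> 0" "y \<noteq> 0"
    and bal: "a2 * a3 * (b2 * b3) = q"
  shows "(x * (qtheta q (b2 / x) * qtheta q (b3 / x))) * (qtheta q (a2 * y) * qtheta q (a3 * y)) -
      (qtheta q (a2 * x) * qtheta q (a3 * x)) * (y * (qtheta q (b2 / y) * qtheta q (b3 / y))) =
      - (qtheta q (a2 * b2) * qtheta q (a3 * b2)) * (y * qtheta q (x / y) * qtheta q (a2 * a3 * x * y))"
    (is "?L y = ?R y")
proof (rule continuous_agree_off_countable[of ?L ?R
      "{y. b2 / y \<in> q_powers} \<union> {y. 1 / (a2 * a3 * b2) / y \<in> q_powers}"])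
  show "continuous_on (-{0}) ?L" "continuous_on (-{0}) ?R"
    using nz by (intro holomorphic_on_imp_continuous_on holomorphic_intros; auto)+
  show "countable ({y. b2 / y \<in> q_powers} \<union> {y. 1 / (a2 * a3 * b2) / y \<in> q_powers})"
    using nz by (intro countable_Un countable_preimage_q_powers[of _ 1]) auto
  fix y assume y: "y \<noteq> 0" "y \<notin> {y. b2 / y \<in> q_powers} \<union> {y. 1 / (a2 * a3 * b2) / y \<in> q_powers}"
  define E where "E = (\<lambda>x. ((qtheta q (a2 * y) * qtheta q (a3 * y)) * (x * (qtheta q (b2 / x) * qtheta q (b3 / x))) -
      (y * (qtheta q (b2 / y) * qtheta q (b3 / y))) * (qtheta q (a2 * x) * qtheta q (a3 * x))) -
      - (qtheta q (a2 * b2) * qtheta q (a3 * b2) * y) * (qtheta q (x / y) * qtheta q (a2 * a3 * y * x)))"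
  have "E x = 0"
  proof (rule theta_functions_eq_0[of E "[y, b2]" "1 / (a2 * a3)"])
    have 1: "(\<lambda>x. x * (qtheta q (b2 / x) * qtheta q (b3 / x))) \<in> theta_functions (int 2) (1 / (a2 * a3))"
    proof (rule theta_functionsI)
      show "(\<lambda>x. x * (qtheta q (b2 / x) * qtheta q (b3 / x))) holomorphic_on -{0}"
        using nz by (intro holomorphic_intros) auto
      fix x :: complex assume x: "x \<noteq> 0"
      have c: "q * x * (- (b2 / (q * x)) * - (b3 / (q * x))) = 1 / (a2 * a3) / x\<^sup>2 * x"
        using x nz by (simp add: power2_eq_square divide_simps) (simp add: bal[symmetric])
      have "q * x * (qtheta q (b2 / (q * x)) * qtheta q (b3 / (q * x))) =
          (q * x * (- (b2 / (q * x)) * - (b3 / (q * x)))) * (qtheta q (b2 / x) * qtheta q (b3 / x))"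
        using x nz by (simp only: qtheta_shift_over mult_ac simp_thms)
      then show "q * x * (qtheta q (b2 / (q * x)) * qtheta q (b3 / (q * x))) =
          1 / (a2 * a3) / x\<^sup>2 * (x * (qtheta q (b2 / x) * qtheta q (b3 / x)))"
        unfolding c by (simp only: mult.assoc)
    qed
    have 2: "(\<lambda>x. qtheta q (a2 * x) * qtheta q (a3 * x)) \<in> theta_functions (int 2) (1 / (a2 * a3))"
      using nz
      by (intro theta_functionsI holomorphic_intros)
         (auto simp: qtheta_shift_left power2_eq_square)
    have 3: "(\<lambda>x. qtheta q (x / y) * qtheta q (a2 * a3 * y * x)) \<in> theta_functions (int 2) (1 / (a2 * a3))"
      using nz y(1)
      by (intro theta_functionsI holomorphic_intros)
         (auto simp: qtheta_shift_left qtheta_shift_div power2_eq_square)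
    show "E \<in> theta_functions (int (length [y, b2])) (1 / (a2 * a3))"
    proof -
      have "int (length [y, b2]) = int 2" by simp
      then show ?thesis
        unfolding E_def by (simp only:) (intro theta_functions_diff theta_functions_cmult 1 2 3)
    qed
    show "E p = 0" if "p \<in> set [y, b2]" for p
    proof -
      have "E y = 0" unfolding E_def using y by simp
      moreover have "a2 * a3 * y * b2 = q / (b3 / y)"
        using bal nz y(1) by (simp add: field_simps)
      then have "qtheta q (a2 * a3 * y * b2) = qtheta q (b3 / y)"
        using nz y(1) by (simp only: qtheta_reflect divide_eq_0_iff simp_thms)
      then have "E b2 = 0" unfolding E_def using nz by simp
      ultimately show ?thesis using that by auto
    qed
  qed (use nz y in \<open>auto simp: mult_ac\<close>)
  then show "?L y = ?R y" unfolding E_def by (simp add: mult_ac eq_neg_iff_add_eq_0)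
qed (use nz in auto)

lemma F1_theta:
  assumes "b1 \<noteq> 0" "b2 \<noteq> 0" "b3 \<noteq> 0" and bal: "t * (b1 * b2 * b3) = q" 
  shows "F1 b1 b2 b3 \<in> theta_functions (int 3) (- 1 / (q * t))"
  unfolding F1_def
proof (rule theta_functionsI)
  fix x :: complex assume x: "x \<noteq> 0"
  have t: "t \<noteq> 0" using bal by auto
  have c: "q * x * (- (b1 / (q * x)) * - (b2 / (q * x)) * - (b3 / (q * x))) = - 1 / (q * t) / x ^ 3 * x"
    using x t by (simp add: power3_eq_cube divide_simps) (simp add: bal[symmetric])
  have "q * x * (qtheta q (b1 / (q * x)) * qtheta q (b2 / (q * x)) * qtheta q (b3 / (q * x))) =
      (q * x * (- (b1 / (q * x)) * - (b2 / (q * x)) * - (b3 / (q * x)))) *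
      (qtheta q (b1 / x) * qtheta q (b2 / x) * qtheta q (b3 / x))"
    using x assms by (simp only: qtheta_shift_over mult_ac simp_thms)
  then show "q * x * (qtheta q (b1 / (q * x)) * qtheta q (b2 / (q * x)) * qtheta q (b3 / (q * x))) =
      - 1 / (q * t) / x ^ 3 * (x * (qtheta q (b1 / x) * qtheta q (b2 / x) * qtheta q (b3 / x)))"
    unfolding c by (simp only: mult.assoc)
qed (intro holomorphic_intros; use assms(1-3) in auto)

lemma F2_theta:
  assumes "a1 \<noteq> 0" "a2 \<noteq> 0" "a3 \<noteq> 0"
  shows "F2 a1 a2 a3 \<in> theta_functions (int 3) (- 1 / (q * (a1 * a2 * a3)))"
  unfolding F2_def using assms
  by (intro theta_functionsI holomorphic_intros)
     (auto simp: qtheta_shift_left power3_eq_cube, simp add: divide_inverse mult_ac)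

lemma F3_theta:
  assumes nz: "a1 \<noteq> 0" "a2 \<noteq> 0" "a3 \<noteq> 0" "b1 \<noteq> 0" "b2 \<noteq> 0" "b3 \<noteq> 0"
    and bal: "a1 * a2 * a3 * (b1 * b2 * b3) = q"
  shows "F3 a1 a2 a3 b1 b2 b3 \<in> theta_functions (int 3) (- 1 / (q * (a1 * a2 * a3)))"
  unfolding F3_def
proof (rule theta_functionsI)
  show "(\<lambda>x. bilateral_sum (a1 * x) (a2 * x) (a3 * x) (x / b1) (x / b2) (x / b3)) holomorphic_on -{0}"
    by (rule holomorphic_bilateral_sum) (use nz in \<open>auto intro!: holomorphic_intros simp: field_simps simp flip: bal\<close>)
  fix x :: complex assume "x \<noteq> 0"
  then show "bilateral_sum (a1 * (q * x)) (a2 * (q * x)) (a3 * (q * x)) (q * x / b1) (q * x / b2) (q * x / b3) =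
      - 1 / (q * (a1 * a2 * a3)) / x ^ 3 * bilateral_sum (a1 * x) (a2 * x) (a3 * x) (x / b1) (x / b2) (x / b3)"
    using bilateral_sum_shift[of "a1 * x" "a2 * x" "a3 * x" "x / b1" "x / b2" "x / b3"] nz
    by (simp add: power3_eq_cube mult_ac)
qed

definition pair_product where
  "pair_product a1 a2 a3 b1 b2 b3 =
    (qpoch_inf q (q / (a1 * b1)) * qpoch_inf q (q / (a1 * b2)) * qpoch_inf q (q / (a1 * b3))) *
    (qpoch_inf q (q / (a2 * b1)) * qpoch_inf q (q / (a2 * b2)) * qpoch_inf q (q / (a2 * b3))) *
    (qpoch_inf q (q / (a3 * b1)) * qpoch_inf q (q / (a3 * b2)) * qpoch_inf q (q / (a3 * b3)))"

text \<open>
  The part of the determinant that depends on the \<open>\<lambda>\<^sub>i\<close>. It is the analogue for theta functions of the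
  Vandermonde determinant; the factor \<open>\<theta>(t x y z)\<close> accounts for the zero that the multiplier imposes.
\<close>

definition theta_vandermonde where
  "theta_vandermonde t x y z = qtheta q (t * x * y * z) / (x * y * z) *
     (y * qtheta q (x / y) * (z * qtheta q (x / z)) * (z * qtheta q (y / z)))"

text \<open>
  At \<open>x = b\<^sub>1\<close> the first factors of the term are \<open>upper_factor 1 k * lower_factor 1 k\<close>. They vanish for
  \<open>k > 0\<close> because \<open>(1)\<^sub>k = 0\<close> and for \<open>k < 0\<close> because \<open>(q\<^sup>k\<^sup>+\<^sup>1)\<^sub>\<infinity> = 0\<close>.
\<close>

lemma F3_special:
  assumes nz: "a1 \<noteq> 0" "a2 \<noteq> 0" "a3 \<noteq> 0" "b1 \<noteq> 0" "b2 \<noteq> 0" "b3 \<noteq> 0" and eq: "a1 * b1 = 1"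
  shows "F3 a1 a2 a3 b1 b2 b3 b1 = (qpoch_inf q q)\<^sup>2 *
     (qpoch_inf q (q / (a2 * b1)) * qpoch_inf q (q / (a3 * b1))) *
     (qpoch_inf q (q * b1 / b2) * qpoch_inf q (q * b1 / b3))"
proof -
  have z: "upper_factor 1 k * lower_factor 1 k = 0" if "k \<noteq> 0" for k
  proof (cases "k > 0")
    case True
    then obtain n where k: "k = int (Suc n)" by (metis gr0_implies_Suc zero_less_imp_eq_int of_nat_0_less_iff)
    have "(\<Prod>j<Suc n. 1 - 1 * q ^ j) = 0" by (subst prod.lessThan_Suc_shift) simp
    then show ?thesis unfolding k upper_factor_of_nat[OF one_neq_zero] by simp
  next
    case False
    define n where "n = nat (- k - 1)"
    have "q powi (k + 1) * 1 * q ^ n = 1"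
      using False that unfolding n_def by (simp flip: power_int_of_nat power_int_add)
    then show ?thesis unfolding lower_factor_def by (auto simp: qpoch_inf_eq_0_iff)
  qed
  define S where "S = bilateral_term 1 (a2 * b1) (a3 * b1) 1 (b1 / b2) (b1 / b3)"
  have "F3 a1 a2 a3 b1 b2 b3 b1 = infsum S UNIV"
    using nz eq by (simp add: F3_def bilateral_sum_def S_def)
  also have "\<dots> = infsum S {0}"
    by (rule infsum_cong_neutral) (auto simp: S_def bilateral_term_def z)
  also have "\<dots> = S 0" by simp
  finally show ?thesis
    by (simp add: S_def bilateral_term_def upper_factor_def lower_factor_def power2_eq_square mult_ac)
qed

lemma det3_theta_functions:
  assumes "f \<in> theta_functions n c" "g \<in> theta_functions n c" "h \<in> theta_functions n c"
  shows "(\<lambda>x. det3 f g h x y z) \<in> theta_functions n c"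
proof -
  have "(\<lambda>x. (g y * h z - h y * g z) * f x + (h y * f z - f y * h z) * g x + (f y * g z - g y * f z) * h x)
      \<in> theta_functions n c"
    by (intro theta_functions_add theta_functions_cmult assms)
  then show ?thesis by (simp add: det3_def algebra_simps)
qed

lemma theta_vandermonde_theta_functions:
  assumes "t \<noteq> 0" "y \<noteq> 0" "z \<noteq> 0"
  shows "(\<lambda>x. theta_vandermonde t x y z) \<in> theta_functions (int 3) (- 1 / (q * t))"
proof (rule theta_functionsI)
  show "(\<lambda>x. theta_vandermonde t x y z) holomorphic_on - {0}"
    unfolding theta_vandermonde_def using assms by (intro holomorphic_intros) auto
  fix x :: complex assume x: "x \<noteq> 0"
  have e: "t * (q * x) * y * z = q * (t * x * y * z)" by simp
  have e': "qtheta q (t * (q * x) * y * z) = - qtheta q (t * x * y * z) / (t * x * y * z)"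
    unfolding e by (rule qtheta_shift) (use assms x in simp)
  then show "theta_vandermonde t (q * x) y z = - 1 / (q * t) / x ^ 3 * theta_vandermonde t x y z"
    unfolding theta_vandermonde_def e' qtheta_shift_div[OF assms(2) x] qtheta_shift_div[OF assms(3) x]
    using assms x by (simp add: field_simps power3_eq_cube)
qed

text \<open>
  For \<open>a\<^sub>1 b\<^sub>1 = 1\<close> the functions \<open>F1\<close> and \<open>F2\<close> have the common factor \<open>\<theta>(b\<^sub>1 / x)\<close>. The remaining minor is
  Weierstrass's identity, which yields the formula at \<open>x = b\<^sub>1\<close>. As functions of \<open>x\<close>, both sides vanish
  at \<open>y\<close> and \<open>z\<close>; so their difference has the three zeros \<open>y\<close>, \<open>z\<close>, \<open>b\<^sub>1\<close>, whose
  product is not the prescribed one for generic \<open>y\<close> and \<open>z\<close>. Continuity in \<open>y\<close> and then in \<open>z\<close> removes the genericity.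
\<close>

lemma theta_det_special:
  assumes nz: "a1 \<noteq> 0" "a2 \<noteq> 0" "a3 \<noteq> 0" "b1 \<noteq> 0" "b2 \<noteq> 0" "b3 \<noteq> 0"
    and eq: "a1 * b1 = 1" and bal: "a1 * a2 * a3 * (b1 * b2 * b3) = q"
    and l: "x \<noteq> 0" "y \<noteq> 0" "z \<noteq> 0"
  shows "theta_det a1 a2 a3 b1 b2 b3 x y z = qpoch_inf q q * pair_product a1 a2 a3 b1 b2 b3 * theta_vandermonde (a1 * a2 * a3) x y z"
proof -
  let ?t = "a1 * a2 * a3"
  let ?f = "F1 b1 b2 b3" and ?g = "F2 a1 a2 a3" and ?h = "F3 a1 a2 a3 b1 b2 b3"
  let ?C = "qpoch_inf q q * pair_product a1 a2 a3 b1 b2 b3"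
  have a1: "a1 = 1 / b1" using eq nz by (simp add: field_simps)
  have bal': "a2 * a3 * (b2 * b3) = q" using bal nz unfolding a1 by (simp add: field_simps)
  have base: "theta_det a1 a2 a3 b1 b2 b3 b1 y z = ?C * theta_vandermonde ?t b1 y z" if y: "y \<noteq> 0" and z: "z \<noteq> 0" for y z
  proof -
    define g1 where "g1 = (\<lambda>x. x * (qtheta q (b2 / x) * qtheta q (b3 / x)))"
    define g2 where "g2 = (\<lambda>x. qtheta q (a2 * x) * qtheta q (a3 * x))"
    have f: "?f x = qtheta q (b1 / x) * g1 x" for x
      by (simp add: F1_def g1_def)
    have g: "?g x = - (1 / b1) * qtheta q (b1 / x) * g2 x" if "x \<noteq> 0" for x
    proof -
      have e: "qtheta q (a1 * x) = - qtheta q (b1 / x) * x / b1"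
        using qtheta_inverse[of "b1 / x"] nz that by (simp add: a1 field_simps)
      show ?thesis unfolding F2_def g2_def e using that nz by simp
    qed
    have f0: "?f b1 = 0" and g0: "?g b1 = 0"
      using f[of b1] g[of b1] nz by auto
    have W: "g1 y * g2 z - g2 y * g1 z =
        - (qtheta q (a2 * b2) * qtheta q (a3 * b2)) * (z * qtheta q (y / z) * qtheta q (a2 * a3 * y * z))"
      unfolding g1_def g2_def by (rule weierstrass_identity) (use nz y z bal' in auto)
    have "theta_det a1 a2 a3 b1 b2 b3 b1 y z = ?h b1 * (?f y * ?g z - ?g y * ?f z)"
      unfolding theta_det_def det3_def using f0 g0 by (simp add: algebra_simps)
    also have "\<dots> = - (?h b1 / b1) * (qtheta q (b1 / y) * qtheta q (b1 / z)) * (g1 y * g2 z - g2 y * g1 z)"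
      using y z by (simp add: f g algebra_simps diff_divide_distrib)
    also have "\<dots> = ?h b1 * qtheta q (a2 * b2) * qtheta q (a3 * b2) * (qtheta q (b1 / y) * qtheta q (b1 / z) *
        (z * qtheta q (y / z) * qtheta q (a2 * a3 * y * z)) / b1)"
      unfolding W by simp
    also have "?h b1 * qtheta q (a2 * b2) * qtheta q (a3 * b2) = ?C"
    proof -
      have e: "q / (a1 * b1) = q" "q / (a1 * b2) = q * b1 / b2" "q / (a1 * b3) = q * b1 / b3"
        "a2 * b2 = q / (a3 * b3)" "a3 * b2 = q / (a2 * b3)"
        using nz bal' by (auto simp: a1 field_simps)
      have e': "qtheta q (a2 * b2) = qpoch_inf q (q / (a3 * b3)) * qpoch_inf q (q / (a2 * b2))"
        "qtheta q (a3 * b2) = qpoch_inf q (q / (a2 * b3)) * qpoch_inf q (q / (a3 * b2))"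
        by (subst qtheta_def, simp only: flip: e(4), subst qtheta_def, simp only: flip: e(5))
      show ?thesis
        unfolding F3_special[OF nz eq] e' pair_product_def e(1-3) by (simp only: power2_eq_square mult_ac)
    qed
    also have "qtheta q (b1 / y) * qtheta q (b1 / z) *
        (z * qtheta q (y / z) * qtheta q (a2 * a3 * y * z)) / b1 = theta_vandermonde ?t b1 y z"
      using y z nz by (simp add: theta_vandermonde_def a1 field_simps)
    finally show ?thesis .
  qed
  have fth: "?f \<in> theta_functions (int 3) (- 1 / (q * ?t))"
    by (rule F1_theta[OF nz(4-6) bal])
  note gth = F2_theta[OF nz(1-3)] and hth = F3_theta[OF nz bal]
  have hol: "?f holomorphic_on -{0}" "?g holomorphic_on -{0}" "?h holomorphic_on -{0}"
    using fth gth hth by (auto simp: theta_functions_def)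
  have generic: "theta_det a1 a2 a3 b1 b2 b3 x y z = ?C * theta_vandermonde ?t x y z"
    if yz: "y \<noteq> 0" "z \<noteq> 0" "b1 / z \<notin> q_powers" "b1 / y \<notin> q_powers" "z / y \<notin> q_powers"
      "1 / (q * ?t * z * b1) / y \<notin> q_powers" for y z
  proof -
    define E where "E = (\<lambda>x. det3 ?f ?g ?h x y z - ?C * theta_vandermonde ?t x y z)"
    have "E x = 0"
    proof (rule theta_functions_eq_0[of E "[y, z, b1]" "- 1 / (q * ?t)"])
      show "E \<in> theta_functions (int (length [y, z, b1])) (- 1 / (q * ?t))"
        unfolding E_def
        using theta_functions_diff[OF det3_theta_functions[OF fth gth hth]
            theta_functions_cmult[OF theta_vandermonde_theta_functions[of ?t y z]]] yz nz by simp
      show "E p = 0" if "p \<in> set [y, z, b1]" for p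
      proof -
        have "E y = 0" "E z = 0" using yz by (auto simp: E_def det3_def theta_vandermonde_def)
        moreover have "E b1 = 0" using base[OF yz(1,2)] by (simp add: E_def theta_det_def)
        ultimately show ?thesis using that by auto
      qed
      have "- 1 / (q * ?t) * (- 1) ^ length [y, z, b1] / prod_list [y, z, b1] = 1 / (q * ?t * z * b1) / y"
        by simp
      then show "- 1 / (q * ?t) * (- 1) ^ length [y, z, b1] / prod_list [y, z, b1] \<notin> q_powers"
        using yz(6) by metis
    qed (use yz nz l in auto)
    then show ?thesis by (simp add: E_def theta_det_def)
  qed
  have generic_z: "theta_det a1 a2 a3 b1 b2 b3 x y z = ?C * theta_vandermonde ?t x y z"
    if z: "z \<noteq> 0" "b1 / z \<notin> q_powers" and "y \<noteq> 0" for y z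
  proof (rule continuous_agree_off_countable[of "\<lambda>y. theta_det a1 a2 a3 b1 b2 b3 x y z" "\<lambda>y. ?C * theta_vandermonde ?t x y z"
        "{y. b1 / y \<in> q_powers} \<union> {y. z / y \<in> q_powers} \<union> {y. 1 / (q * ?t * z * b1) / y \<in> q_powers}"])
    show "continuous_on (-{0}) (\<lambda>y. theta_det a1 a2 a3 b1 b2 b3 x y z)"
      unfolding theta_det_def det3_def by (intro holomorphic_on_imp_continuous_on holomorphic_intros hol)
    show "continuous_on (-{0}) (\<lambda>y. ?C * theta_vandermonde ?t x y z)"
      unfolding theta_vandermonde_def using nz l z by (intro holomorphic_on_imp_continuous_on holomorphic_intros) auto
    show "countable ({y. b1 / y \<in> q_powers} \<union> {y. z / y \<in> q_powers} \<union> {y. 1 / (q * ?t * z * b1) / y \<in> q_powers})"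
      using nz z by (intro countable_Un countable_preimage_q_powers[of _ 1]) auto
    fix y assume "y \<noteq> 0" and y: "y \<notin> {y. b1 / y \<in> q_powers} \<union> {y. z / y \<in> q_powers} \<union>
        {y. 1 / (q * ?t * z * b1) / y \<in> q_powers}"
    show "theta_det a1 a2 a3 b1 b2 b3 x y z = ?C * theta_vandermonde ?t x y z"
      by (rule generic) (use y z \<open>y \<noteq> 0\<close> in auto)
  qed fact
  show ?thesis
  proof (rule continuous_agree_off_countable[of "\<lambda>z. theta_det a1 a2 a3 b1 b2 b3 x y z" "\<lambda>z. ?C * theta_vandermonde ?t x y z"
        "{z. b1 / z \<in> q_powers}"])
    show "continuous_on (-{0}) (\<lambda>z. theta_det a1 a2 a3 b1 b2 b3 x y z)"
      unfolding theta_det_def det3_def by (intro holomorphic_on_imp_continuous_on holomorphic_intros hol)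
    show "continuous_on (-{0}) (\<lambda>z. ?C * theta_vandermonde ?t x y z)"
      unfolding theta_vandermonde_def using nz l by (intro holomorphic_on_imp_continuous_on holomorphic_intros) auto
    show "countable {z. b1 / z \<in> q_powers}"
      using nz by (intro countable_preimage_q_powers[of _ 1]) auto
    show "theta_det a1 a2 a3 b1 b2 b3 x y z = ?C * theta_vandermonde ?t x y z" if "z \<noteq> 0" "z \<notin> {z. b1 / z \<in> q_powers}" for z
      using generic_z[of z y] that l by simp
  qed fact
qed

end

context q_base
begin

section \<open>The determinant for arbitrary parameters\<close>

lemma bilateral_term_swap:
  "bilateral_term X2 X1 X3 Y1 Y2 Y3 = bilateral_term X1 X2 X3 Y1 Y2 Y3"
  "bilateral_term X1 X3 X2 Y1 Y2 Y3 = bilateral_term X1 X2 X3 Y1 Y2 Y3"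
  "bilateral_term X1 X2 X3 Y2 Y1 Y3 = bilateral_term X1 X2 X3 Y1 Y2 Y3"
  "bilateral_term X1 X2 X3 Y1 Y3 Y2 = bilateral_term X1 X2 X3 Y1 Y2 Y3"
  by (rule ext, simp only: bilateral_term_def mult_ac)+

definition determinant_formula where
  "determinant_formula a1 a2 a3 b1 b2 b3 x y z \<longleftrightarrow>
     theta_det a1 a2 a3 b1 b2 b3 x y z = qpoch_inf q q * pair_product a1 a2 a3 b1 b2 b3 * theta_vandermonde (a1 * a2 * a3) x y z"

lemma theta_det_swap:
  "theta_det a2 a1 a3 b1 b2 b3 = theta_det a1 a2 a3 b1 b2 b3"
  "theta_det a1 a3 a2 b1 b2 b3 = theta_det a1 a2 a3 b1 b2 b3"
  "theta_det a1 a2 a3 b2 b1 b3 = theta_det a1 a2 a3 b1 b2 b3"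
  "theta_det a1 a2 a3 b1 b3 b2 = theta_det a1 a2 a3 b1 b2 b3"
proof -
  have F2: "F2 a2 a1 a3 = F2 a1 a2 a3" "F2 a1 a3 a2 = F2 a1 a2 a3"
    by (rule ext, simp only: F2_def mult_ac)+
  have F1: "F1 b2 b1 b3 = F1 b1 b2 b3" "F1 b1 b3 b2 = F1 b1 b2 b3"
    by (rule ext, simp only: F1_def mult_ac)+
  have F3: "F3 a2 a1 a3 b1 b2 b3 = F3 a1 a2 a3 b1 b2 b3" "F3 a1 a3 a2 b1 b2 b3 = F3 a1 a2 a3 b1 b2 b3"
    "F3 a1 a2 a3 b2 b1 b3 = F3 a1 a2 a3 b1 b2 b3" "F3 a1 a2 a3 b1 b3 b2 = F3 a1 a2 a3 b1 b2 b3"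
    by (rule ext, simp only: F3_def bilateral_sum_def bilateral_term_swap)+
  show "theta_det a2 a1 a3 b1 b2 b3 = theta_det a1 a2 a3 b1 b2 b3" "theta_det a1 a3 a2 b1 b2 b3 = theta_det a1 a2 a3 b1 b2 b3"
    "theta_det a1 a2 a3 b2 b1 b3 = theta_det a1 a2 a3 b1 b2 b3" "theta_det a1 a2 a3 b1 b3 b2 = theta_det a1 a2 a3 b1 b2 b3"
    unfolding theta_det_def F1 F2 F3 by (rule refl)+
qed

lemma pair_product_swap:
  "pair_product a2 a1 a3 b1 b2 b3 = pair_product a1 a2 a3 b1 b2 b3"
  "pair_product a1 a3 a2 b1 b2 b3 = pair_product a1 a2 a3 b1 b2 b3"
  "pair_product a1 a2 a3 b2 b1 b3 = pair_product a1 a2 a3 b1 b2 b3"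
  "pair_product a1 a2 a3 b1 b3 b2 = pair_product a1 a2 a3 b1 b2 b3"
  by (simp_all only: pair_product_def mult_ac)

lemma determinant_formula_swap:
  "determinant_formula a2 a1 a3 b1 b2 b3 x y z = determinant_formula a1 a2 a3 b1 b2 b3 x y z"
  "determinant_formula a1 a3 a2 b1 b2 b3 x y z = determinant_formula a1 a2 a3 b1 b2 b3 x y z"
  "determinant_formula a1 a2 a3 b2 b1 b3 x y z = determinant_formula a1 a2 a3 b1 b2 b3 x y z"
  "determinant_formula a1 a2 a3 b1 b3 b2 x y z = determinant_formula a1 a2 a3 b1 b2 b3 x y z"
proof -
  have "a2 * a1 * a3 = a1 * a2 * a3" "a1 * a3 * a2 = a1 * a2 * a3" by simp_all
  then show "determinant_formula a2 a1 a3 b1 b2 b3 x y z = determinant_formula a1 a2 a3 b1 b2 b3 x y z"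
    "determinant_formula a1 a3 a2 b1 b2 b3 x y z = determinant_formula a1 a2 a3 b1 b2 b3 x y z"
    unfolding determinant_formula_def theta_det_swap(1)[of a2] theta_det_swap(2)[of a1 a3] pair_product_swap(1)[of a2] pair_product_swap(2)[of a1 a3]
    by (simp_all only:)
  show "determinant_formula a1 a2 a3 b2 b1 b3 x y z = determinant_formula a1 a2 a3 b1 b2 b3 x y z"
    "determinant_formula a1 a2 a3 b1 b3 b2 x y z = determinant_formula a1 a2 a3 b1 b2 b3 x y z"
    unfolding determinant_formula_def theta_det_swap(3)[of a1 a2 a3 b2] theta_det_swap(4)[of a1 a2 a3 b1 b3]
      pair_product_swap(3)[of a1 a2 a3 b2] pair_product_swap(4)[of a1 a2 a3 b1 b3] by (rule refl)+
qed

lemma determinant_formula_rotate: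
  "determinant_formula a3 a1 a2 b1 b2 b3 x y z = determinant_formula a1 a2 a3 b1 b2 b3 x y z"
  "determinant_formula a1 a2 a3 b3 b1 b2 x y z = determinant_formula a1 a2 a3 b1 b2 b3 x y z"
  by (metis determinant_formula_swap(1,2)) (metis determinant_formula_swap(3,4))

lemma qpoch_inf_neq_0:
  assumes "cmod a < 1" shows "qpoch_inf q a \<noteq> 0"
proof
  assume "qpoch_inf q a = 0"
  then obtain n where "a * q ^ n = 1" by (auto simp: qpoch_inf_eq_0_iff)
  then have "cmod a * cmod q ^ n = 1" by (metis norm_mult norm_one norm_power)
  moreover have "cmod a * cmod q ^ n \<le> cmod a"
    using norm_q by (intro mult_left_le) (auto intro: power_le_one)
  ultimately show False using assms by simp
qed

lemma pair_product_contiguous: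
  assumes "u \<noteq> 0" "v \<noteq> 0" "b1 \<noteq> 0" "b2 \<noteq> 0" "b3 \<noteq> 0"
  shows "(1 - 1/(v * b1)) * (1 - 1/(v * b2)) * (1 - 1/(v * b3)) * pair_product (q * u) v w b1 b2 b3 =
         (1 - 1/(u * b1)) * (1 - 1/(u * b2)) * (1 - 1/(u * b3)) * pair_product u (q * v) w b1 b2 b3"
proof -
  have 1: "qpoch_inf q (q / (q * c * b)) = (1 - 1 / (c * b)) * qpoch_inf q (q / (c * b))" for c b
    using qpoch_inf_rec[of "1 / (c * b)"] by simp
  show ?thesis
    unfolding pair_product_def 1 by (simp only: mult_ac)
qed

text \<open>
  Both sides satisfy the same contiguous relation, so the formula for \<open>(q u, v, w)\<close> gives the one for
  \<open>(u, q v, w)\<close>, provided the coefficient of the latter does not vanish.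
\<close>

lemma determinant_formula_contiguous:
  assumes nz: "u \<noteq> 0" "v \<noteq> 0" "w \<noteq> 0" "b1 \<noteq> 0" "b2 \<noteq> 0" "b3 \<noteq> 0"
      "x \<noteq> 0" "y \<noteq> 0" "z \<noteq> 0"
    and bal: "u * v * w * (b1 * b2 * b3) = 1"
    and ne: "u * b1 \<noteq> 1" "u * b2 \<noteq> 1" "u * b3 \<noteq> 1"
    and formula: "determinant_formula (q * u) v w b1 b2 b3 x y z"
  shows "determinant_formula u (q * v) w b1 b2 b3 x y z"
proof -
  let ?A = "(1 - 1/(u * b1)) * (1 - 1/(u * b2)) * (1 - 1/(u * b3))"
  let ?B = "(1 - 1/(v * b1)) * (1 - 1/(v * b2)) * (1 - 1/(v * b3))"
  let ?V = "theta_vandermonde (u * (q * v) * w) x y z"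
  have t: "q * u * v * w = u * (q * v) * w" by simp
  have "?A * theta_det u (q * v) w b1 b2 b3 x y z = ?B * theta_det (q * u) v w b1 b2 b3 x y z"
    by (rule theta_det_contiguous[OF nz bal, symmetric])
  also have "\<dots> = qpoch_inf q q * (?B * pair_product (q * u) v w b1 b2 b3) * ?V"
    using formula unfolding determinant_formula_def t by (simp only: mult_ac)
  also have "\<dots> = ?A * (qpoch_inf q q * pair_product u (q * v) w b1 b2 b3 * ?V)"
    unfolding pair_product_contiguous[OF nz(1,2,4-6)] by (simp only: mult_ac)
  finally have "?A * theta_det u (q * v) w b1 b2 b3 x y z = ?A * (qpoch_inf q q * pair_product u (q * v) w b1 b2 b3 * ?V)" .
  moreover have "?A \<noteq> 0" using ne nz by simp
  ultimately show ?thesis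
    unfolding determinant_formula_def using mult_left_cancel by blast
qed

text \<open>
  Let \<open>u\<close> vary with \<open>s = a\<^sub>1 a\<^sub>2\<close> fixed. The factors of the product that depend on \<open>u\<close> are
  \<open>(q / u b\<^sub>j)\<^sub>\<infinity>\<close> and \<open>(q u / s b\<^sub>j)\<^sub>\<infinity>\<close>, with no zeros for \<open>\<bar>q / b\<^sub>1\<bar> < \<bar>u\<bar> < \<bar>s b\<^sub>1 / q\<bar>\<close> when \<open>b\<^sub>1\<close> has the
  least modulus. The smallness of \<open>a\<^sub>3\<close> says precisely that this annulus contains \<open>1 / b\<^sub>1\<close>, the point
  of the special case, and also that it is wider than one period.
\<close>

lemma determinant_formula_annulus:
  assumes nz: "a1 \<noteq> 0" "a2 \<noteq> 0" "a3 \<noteq> 0" "b1 \<noteq> 0" "b2 \<noteq> 0" "b3 \<noteq> 0"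
      "x \<noteq> 0" "y \<noteq> 0" "z \<noteq> 0"
    and bal: "a1 * a2 * a3 * (b1 * b2 * b3) = q"
    and min: "cmod b1 \<le> cmod b2" "cmod b1 \<le> cmod b3"
    and small: "cmod a3 * cmod (b1 * b2 * b3) < (cmod b1)\<^sup>2"
  shows "determinant_formula a1 a2 a3 b1 b2 b3 x y z"
proof -
  define s where "s = a1 * a2"
  have s0: "s \<noteq> 0" using nz by (simp add: s_def)
  have sbal: "s * a3 * (b1 * b2 * b3) = q" using bal by (simp add: s_def)
  have "cmod q = cmod s * (cmod a3 * cmod (b1 * b2 * b3))"
    unfolding sbal[symmetric] norm_mult by (simp only: mult_ac)
  also have "\<dots> < cmod s * (cmod b1)\<^sup>2" using small s0 by simp
  finally have s: "cmod q < cmod s * cmod b1 * cmod b1" by (simp add: power2_eq_square)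
  define R where "R = (\<lambda>u. theta_det u (s / u) a3 b1 b2 b3 x y z)"
  \<comment> \<open>The constant factors \<open>(q / a\<^sub>3 b\<^sub>j)\<^sub>\<infinity>\<close> may vanish and must not enter the denominator.\<close>
  define P0 where "P0 = (\<lambda>u.
    (qpoch_inf q (q / (u * b1)) * qpoch_inf q (q / (u * b2)) * qpoch_inf q (q / (u * b3))) *
    (qpoch_inf q (q * u / (s * b1)) * qpoch_inf q (q * u / (s * b2)) * qpoch_inf q (q * u / (s * b3))))"
  define Pw where "Pw = qpoch_inf q (q / (a3 * b1)) * qpoch_inf q (q / (a3 * b2)) * qpoch_inf q (q / (a3 * b3))"
  define r1 where "r1 = cmod q / cmod b1"
  define r2 where "r2 = cmod s * cmod b1 / cmod q"
  let ?U = "{u. r1 < cmod u \<and> cmod u < r2}"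
  have PP: "pair_product u (s / u) a3 b1 b2 b3 = P0 u * Pw" if "u \<noteq> 0" for u
    using that by (simp add: pair_product_def P0_def Pw_def)
  have r1: "0 \<le> r1" by (simp add: r1_def)
  have U0: "u \<noteq> 0" if "u \<in> ?U" for u using that r1 by auto
  have holP0: "P0 holomorphic_on -{0}"
    unfolding P0_def using nz s0 by (intro holomorphic_intros) auto
  have holR: "R holomorphic_on -{0}"
  proof -
    have "(\<lambda>u. F2 u (s / u) a3 l) holomorphic_on -{0}" if "l \<noteq> 0" for l
      unfolding F2_def using that nz s0 by (intro holomorphic_intros) auto
    moreover have "(\<lambda>u. F3 u (s / u) a3 b1 b2 b3 l) holomorphic_on -{0}" if "l \<noteq> 0" for l
      unfolding F3_def
    proof (rule holomorphic_bilateral_sum)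
      show "u * l * (s / u * l) * (a3 * l) = q * (l / b1 * (l / b2) * (l / b3))" if "u \<in> -{0}" for u
        using that nz by (simp add: field_simps flip: sbal)
    qed (use that nz s0 in \<open>auto intro!: holomorphic_intros\<close>)
    ultimately show ?thesis
      unfolding R_def theta_det_def det3_def using nz by (intro holomorphic_intros) auto
  qed
  have lt: "cmod (q / (u * b)) < 1" if "u \<in> ?U" "cmod b1 \<le> cmod b" for u b
  proof -
    have "cmod q < cmod u * cmod b1" using that(1) nz by (simp add: r1_def field_simps)
    also have "\<dots> \<le> cmod u * cmod b" using that(2) by (intro mult_left_mono) auto
    finally have less: "cmod q < cmod u * cmod b" .
    then have "0 < cmod u * cmod b" using norm_q by linarith
    then show ?thesis using less by (simp only: norm_divide norm_mult divide_less_eq_1_pos)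
  qed
  have lt': "cmod (q * u / (s * b)) < 1" if "u \<in> ?U" "cmod b1 \<le> cmod b" for u b
  proof -
    have "cmod q * cmod u < cmod s * cmod b1" using that(1) norm_q by (simp add: r2_def field_simps)
    also have "\<dots> \<le> cmod s * cmod b" using that(2) by (intro mult_left_mono) auto
    finally have less: "cmod q * cmod u < cmod s * cmod b" .
    moreover have "0 \<le> cmod q * cmod u" by simp
    ultimately have "0 < cmod s * cmod b" by linarith
    then show ?thesis using less by (simp only: norm_divide norm_mult divide_less_eq_1_pos)
  qed
  have P0_nz: "P0 u \<noteq> 0" if "u \<in> ?U" for u
    unfolding P0_def mult_eq_0_iff de_Morgan_disj
    by (intro conjI qpoch_inf_neq_0 lt[OF that] lt'[OF that] min order_refl)
  have "(\<lambda>u. R u / P0 u) constant_on ?U"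
  proof (rule q_periodic_on_annulus_constant[OF _ r1])
    have sub: "?U \<subseteq> -{0}" using r1 by auto
    show "(\<lambda>u. R u / P0 u) holomorphic_on ?U"
      by (intro holomorphic_intros holomorphic_on_subset[OF holR sub] holomorphic_on_subset[OF holP0 sub] P0_nz)
    show "r1 < cmod q * r2" using s nz norm_q by (simp add: r1_def r2_def field_simps)
    fix u assume "r1 < cmod (q * u)" "cmod u < r2"
    moreover have "cmod (q * u) \<le> cmod u" using norm_q by (simp add: norm_mult mult_left_le_one_le)
    ultimately have u: "u \<in> ?U" and qu: "q * u \<in> ?U" by auto
    have u0: "u \<noteq> 0" using U0 u by blast
    let ?v = "s / u / q"
    let ?A = "(1 - 1/(u * b1)) * (1 - 1/(u * b2)) * (1 - 1/(u * b3))"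
    let ?B = "(1 - 1/(?v * b1)) * (1 - 1/(?v * b2)) * (1 - 1/(?v * b3))"
    have qv: "q * ?v = s / u" "?v = s / (q * u)" by simp_all
    have v0: "?v \<noteq> 0" using s0 u0 by simp
    have vbal: "u * ?v * a3 * (b1 * b2 * b3) = 1"
      using sbal u0 by (simp add: field_simps)
    have R: "?B * R (q * u) = ?A * R u"
      using theta_det_contiguous[OF u0 v0 nz(3-9) vbal] unfolding R_def qv by simp
    have P: "?B * P0 (q * u) = ?A * P0 u"
    proof -
      have 1: "qpoch_inf q (q / (q * u * b)) = (1 - 1 / (u * b)) * qpoch_inf q (q / (u * b))" for b
        using qpoch_inf_rec[of "1 / (u * b)"] by simp
      have 2: "qpoch_inf q (q * u / (s * b)) = (1 - 1 / (?v * b)) * qpoch_inf q (q * (q * u) / (s * b))" for b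
        using qpoch_inf_rec[of "q * u / (s * b)"] by (simp add: field_simps)
      show ?thesis
        unfolding P0_def 1 2[of b1] 2[of b2] 2[of b3] by (simp only: mult_ac)
    qed
    have "1 - 1/(?v * b) \<noteq> 0" if "cmod b1 \<le> cmod b" for b
    proof -
      have e: "1/(?v * b) = q * u / (s * b)" by (simp add: field_simps)
      show ?thesis
      proof
        assume "1 - 1/(?v * b) = 0"
        then have "cmod (q * u / (s * b)) = 1" unfolding e by (metis eq_iff_diff_eq_0 norm_one)
        then show False using lt'[OF u that] by simp
      qed
    qed
    then have B: "?B \<noteq> 0" using min by simp
    have cross: "r' / p' = r / p"
      if eqs: "\<beta> * r' = \<alpha> * r" "\<beta> * p' = \<alpha> * p" and ne: "\<beta> \<noteq> 0" "p \<noteq> 0" "p' \<noteq> 0"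
      for \<alpha> \<beta> r r' p p' :: complex
    proof -
      have "r' = \<beta> * r' / \<beta>" "p' = \<beta> * p' / \<beta>" using ne by simp_all
      then have "r' = \<alpha> * r / \<beta>" "p' = \<alpha> * p / \<beta>" unfolding eqs .
      moreover from this have "\<alpha> \<noteq> 0" using ne by auto
      ultimately show ?thesis using ne by simp
    qed
    show "R (q * u) / P0 (q * u) = R u / P0 u"
      by (rule cross[OF R P B P0_nz[OF u] P0_nz[OF qu]])
  qed
  then obtain c where c: "\<And>u. u \<in> ?U \<Longrightarrow> R u / P0 u = c"
    unfolding constant_on_def by blast
  have u0: "1 / b1 \<in> ?U"
    using s nz norm_q by (auto simp: r1_def r2_def norm_divide field_simps)
  have t: "1 / b1 * (s / (1 / b1)) * a3 = a1 * a2 * a3" using nz by (simp add: s_def)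
  have "R (1 / b1) = qpoch_inf q q * (P0 (1 / b1) * Pw) * theta_vandermonde (a1 * a2 * a3) x y z"
    unfolding R_def PP[OF U0[OF u0], symmetric] t[symmetric]
    by (rule theta_det_special) (use nz s0 sbal in auto)
  then have "c = qpoch_inf q q * Pw * theta_vandermonde (a1 * a2 * a3) x y z"
    using c[OF u0] P0_nz[OF u0] by (simp add: field_simps)
  moreover have "R a1 = c * P0 a1"
  proof (rule analytic_continuation_open[of ?U "-{0}" R "\<lambda>u. c * P0 u"])
    show "open ?U" by (intro open_Collect_conj open_Collect_less continuous_intros)
    show "connected (-{0::complex})" by (rule connected_punctured_universe) simp
    show "(\<lambda>u. c * P0 u) holomorphic_on -{0}" by (intro holomorphic_intros holP0)
    show "R u = c * P0 u" if "u \<in> ?U" for u using c[OF that] P0_nz[OF that] by (simp add: field_simps)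
    show "?U \<noteq> {}" "?U \<subseteq> -{0}" using u0 r1 by auto
  qed (use holR nz in auto)
  moreover have "s / a1 = a2" using nz by (simp add: s_def)
  ultimately show ?thesis
    using PP[OF nz(1)] unfolding determinant_formula_def R_def by simp
qed

text \<open>
  Induction on the number of steps \<open>(a\<^sub>1, a\<^sub>3) \<mapsto> (a\<^sub>1 / q, q a\<^sub>3)\<close> needed to make \<open>a\<^sub>3\<close> small. A step cannot be
  taken if \<open>a\<^sub>3 b\<^sub>j = 1\<close> for some \<open>j\<close>, but then the special evaluation applies directly, with \<open>a\<^sub>3\<close> and
  \<open>b\<^sub>j\<close> in the first places.
\<close>

lemma determinant_formula_min:
  assumes nz: "a1 \<noteq> 0" "a2 \<noteq> 0" "a3 \<noteq> 0" "b1 \<noteq> 0" "b2 \<noteq> 0" "b3 \<noteq> 0"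
      "x \<noteq> 0" "y \<noteq> 0" "z \<noteq> 0"
    and bal: "a1 * a2 * a3 * (b1 * b2 * b3) = q"
    and min: "cmod b1 \<le> cmod b2" "cmod b1 \<le> cmod b3"
    and small: "cmod q ^ N * (cmod a3 * cmod (b1 * b2 * b3)) < (cmod b1)\<^sup>2"
  shows "determinant_formula a1 a2 a3 b1 b2 b3 x y z"
  using nz(1,3) bal small
proof (induction N arbitrary: a1 a3)
  case 0
  then show ?case using determinant_formula_annulus nz min by simp
next
  case (Suc N)
  note a = Suc.prems(1,2)
  have special: "determinant_formula a3 a2 a1 c1 c2 c3 x y z"
    if "a3 * c1 = 1" "c1 \<noteq> 0" "c2 \<noteq> 0" "c3 \<noteq> 0" "c1 * c2 * c3 = b1 * b2 * b3" for c1 c2 c3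
    unfolding determinant_formula_def
    by (rule theta_det_special) (use that a nz Suc.prems(3) in \<open>auto simp: mult_ac\<close>)
  have swap: "determinant_formula a1 a2 a3 c1 c2 c3 x y z = determinant_formula a3 a2 a1 c1 c2 c3 x y z" for c1 c2 c3
    by (metis determinant_formula_swap(1,2))
  consider "a3 * b1 = 1" | "a3 * b2 = 1" | "a3 * b3 = 1" | "a3 * b1 \<noteq> 1" "a3 * b2 \<noteq> 1" "a3 * b3 \<noteq> 1"
    by blast
  then show ?case
  proof cases
    case 1
    then show ?thesis using special[of b1 b2 b3] swap nz by simp
  next
    case 2
    have "determinant_formula a3 a2 a1 b2 b1 b3 x y z" by (rule special) (use 2 nz in auto)
    then show ?thesis unfolding swap determinant_formula_swap(3)[of a3 a2 a1 b2] .
  next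
    case 3
    have "determinant_formula a3 a2 a1 b3 b1 b2 x y z" by (rule special) (use 3 nz in auto)
    then show ?thesis unfolding swap determinant_formula_rotate(2)[of a3 a2 a1 b3] .
  next
    case 4
    have "determinant_formula (a1 / q) a2 (q * a3) b1 b2 b3 x y z"
    proof (rule Suc.IH)
      show "a1 / q * a2 * (q * a3) * (b1 * b2 * b3) = q" using Suc.prems(3) by (simp add: mult.assoc)
      show "cmod q ^ N * (cmod (q * a3) * cmod (b1 * b2 * b3)) < (cmod b1)\<^sup>2"
        using Suc.prems(4) by (simp add: norm_mult mult_ac)
    qed (use a in auto)
    then have "determinant_formula (q * a3) (a1 / q) a2 b1 b2 b3 x y z"
      unfolding determinant_formula_rotate(1)[of "q * a3"] .
    then have "determinant_formula a3 (q * (a1 / q)) a2 b1 b2 b3 x y z"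
      by (intro determinant_formula_contiguous)
         (use 4 a nz Suc.prems(3) in \<open>auto simp: field_simps\<close>)
    then show ?thesis by (simp add: determinant_formula_rotate(1)[of a3])
  qed
qed

lemma determinant_formula_holds:
  assumes nz: "a1 \<noteq> 0" "a2 \<noteq> 0" "a3 \<noteq> 0" "b1 \<noteq> 0" "b2 \<noteq> 0" "b3 \<noteq> 0"
      "x \<noteq> 0" "y \<noteq> 0" "z \<noteq> 0"
    and bal: "a1 * a2 * a3 * (b1 * b2 * b3) = q"
  shows "determinant_formula a1 a2 a3 b1 b2 b3 x y z"
proof -
  have minimal: "determinant_formula a1 a2 a3 c1 c2 c3 x y z"
    if "c1 \<noteq> 0" "c2 \<noteq> 0" "c3 \<noteq> 0" "c1 * c2 * c3 = b1 * b2 * b3"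
      "cmod c1 \<le> cmod c2" "cmod c1 \<le> cmod c3" for c1 c2 c3
  proof -
    let ?K = "cmod a3 * cmod (c1 * c2 * c3)"
    have K: "0 < ?K" "0 < (cmod c1)\<^sup>2 / ?K" using that nz by auto
    obtain N where "cmod q ^ N < (cmod c1)\<^sup>2 / ?K"
      using real_arch_pow_inv[OF K(2) norm_q(2)] by blast
    then have "cmod q ^ N * ?K < (cmod c1)\<^sup>2" using K(1) by (simp add: less_divide_eq)
    then show ?thesis
      by (intro determinant_formula_min) (use that nz bal in auto)
  qed
  consider "cmod b1 \<le> cmod b2" "cmod b1 \<le> cmod b3" | "cmod b2 \<le> cmod b1" "cmod b2 \<le> cmod b3"
    | "cmod b3 \<le> cmod b1" "cmod b3 \<le> cmod b2" by linarith
  then show ?thesis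
  proof cases
    case 1
    then show ?thesis using minimal[of b1 b2 b3] nz by simp
  next
    case 2
    have "determinant_formula a1 a2 a3 b2 b1 b3 x y z" by (rule minimal) (use 2 nz in auto)
    then show ?thesis unfolding determinant_formula_swap(3)[of a1 a2 a3 b2] .
  next
    case 3
    have "determinant_formula a1 a2 a3 b3 b1 b2 x y z" by (rule minimal) (use 3 nz in auto)
    then show ?thesis unfolding determinant_formula_rotate(2)[of a1 a2 a3 b3] .
  qed
qed

section \<open>Comparison with the unregularised series\<close>

lemma qpoch_rec:
  "k \<ge> 0 \<Longrightarrow> qpoch q a (k + 1) = (1 - a * q powi k) * qpoch q a k"
  "k \<le> 0 \<Longrightarrow> qpoch q a (k - 1) = inverse (1 - a * q powi (k - 1)) * qpoch q a k"
proof -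
  assume "k \<ge> 0"
  then have "{0..<k + 1} = insert k {0..<k}" by auto
  then show "qpoch q a (k + 1) = (1 - a * q powi k) * qpoch q a k"
    using \<open>k \<ge> 0\<close> by (simp add: qpoch_def)
next
  assume "k \<le> 0"
  then have "{k - 1..-1} = insert (k - 1) {k..-1}" by auto
  then show "qpoch q a (k - 1) = inverse (1 - a * q powi (k - 1)) * qpoch q a k"
    using \<open>k \<le> 0\<close> by (cases "k = 0") (auto simp: qpoch_def)
qed

lemma qpoch_0 [simp]: "qpoch q a 0 = 1"
  by (simp add: qpoch_def)

lemma upper_factor_eq_qpoch:
  assumes "x \<noteq> 0" and gen: "\<And>n::nat. n \<ge> 1 \<Longrightarrow> 1 - x * q powi (- int n) \<noteq> 0"
  shows "upper_factor x k = qpoch_inf q (q / x) * qpoch q x k"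
proof (induction k rule: int_induct[of _ 0])
  case base
  then show ?case by (simp add: upper_factor_def)
next
  case (step1 i)
  then show ?case using assms(1) by (simp add: upper_factor_Suc qpoch_rec(1))
next
  case (step2 i)
  have "i - 1 = - int (nat (1 - i))" "nat (1 - i) \<ge> 1" using step2 by auto
  then have "1 - x * q powi (i - 1) \<noteq> 0" using gen by metis
  moreover have "upper_factor x i = (1 - x * q powi (i - 1)) * upper_factor x (i - 1)"
    using upper_factor_Suc[OF assms(1), of "i - 1"] by simp
  ultimately show ?case using step2 by (simp add: qpoch_rec(2) field_simps)
qed

text \<open>
  For \<open>k < 0\<close> the factor \<open>(q y)\<^sub>k\<close> may be the inverse of \<open>0\<close>, hence \<open>0\<close>. Division by it then gives \<open>0\<close>,
  which is the correct value of \<open>(q\<^sup>k\<^sup>+\<^sup>1 y)\<^sub>\<infinity>\<close>.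
\<close>

lemma lower_factor_eq_qpoch:
  assumes gen: "\<And>n::nat. 1 - q * y * q ^ n \<noteq> 0"
  shows "lower_factor y k = qpoch_inf q (q * y) / qpoch q (q * y) k"
proof (induction k rule: int_induct[of _ 0])
  case base
  then show ?case by (simp add: lower_factor_def)
next
  case (step1 i)
  have e: "q * y * q powi i = q powi (i + 1) * y" by (simp add: power_int_add_1)
  have "q powi i = q ^ nat i" using step1 by (simp add: power_int_def)
  then have "1 - q * y * q powi i \<noteq> 0" using gen[of "nat i"] by simp
  moreover have "lower_factor y i = (1 - q * y * q powi i) * lower_factor y (i + 1)"
    using lower_factor_Suc[of y i] unfolding e .
  ultimately have "lower_factor y (i + 1) = lower_factor y i / (1 - q * y * q powi i)" by simp
  then show ?case unfolding step1(2) qpoch_rec(1)[OF step1(1)] by (simp add: mult_ac)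
next
  case (step2 i)
  have "q powi i = q * q powi (i - 1)" using power_int_add_1'[of q "i - 1"] by simp
  then have e: "q * y * q powi (i - 1) = q powi i * y" by (simp only: mult_ac)
  have "lower_factor y (i - 1) = (1 - q * y * q powi (i - 1)) * lower_factor y i"
    using lower_factor_Suc[of y "i - 1"] unfolding e by simp
  then show ?case using step2 by (simp add: qpoch_rec(2) divide_inverse)
qed

lemma prod_UNIV_3: "prod f (UNIV :: 3 set) = f 1 * f 2 * f 3"
  unfolding UNIV_3 by (simp add: mult.assoc)

lemma f1_eq: "f1 q b x = F1 (b $ 1) (b $ 2) (b $ 3) x"
  by (simp add: f1_def F1_def prod_UNIV_3)

lemma f2_eq: "f2 q a x = F2 (a $ 1) (a $ 2) (a $ 3) x"
  by (simp add: f2_def F2_def prod_UNIV_3)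

lemma f3_eq:
  fixes a b :: "complex ^ 3"
  assumes "x \<noteq> 0" "\<And>i. a $ i \<noteq> 0"
    and upper: "\<And>j (n::nat). n \<ge> 1 \<Longrightarrow> 1 - a $ j * x * q powi (- int n) \<noteq> 0"
    and lower: "\<And>j (n::nat). 1 - (q * x / b $ j) * q ^ n \<noteq> 0"
  shows "f3 q a b x = F3 (a $ 1) (a $ 2) (a $ 3) (b $ 1) (b $ 2) (b $ 3) x"
proof -
  have upper_factor: "upper_factor (a $ j * x) k = qpoch_inf q (q / (a $ j * x)) * qpoch q (a $ j * x) k" for j k
    by (rule upper_factor_eq_qpoch) (use assms in auto)
  have lower_factor: "lower_factor (x / b $ j) k = qpoch_inf q (q * x / b $ j) / qpoch q (q * x / b $ j) k" for j k
    using lower_factor_eq_qpoch[of "x / b $ j" k] lower by simp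
  show ?thesis
    unfolding f3_def F3_def bilateral_sum_def bilateral_psi_def infsum_cmult_right'[symmetric]
    by (rule infsum_cong) (simp only: bilateral_term_def upper_factor lower_factor prod_UNIV_3 vec_lambda_beta, simp add: mult_ac)
qed

end

(* The pairs i < j are listed explicitly because the order of the index type 3
   identifies the numeral 3 with 0, so that 3 < 1 < 2 there. *)
theorem proposition2p2:
  fixes q t :: complex and a b l :: "complex ^ 3"
  assumes q: "0 < cmod q" "cmod q < 1"
    and nonzero: "\<And>i. a $ i \<noteq> 0" "\<And>i. b $ i \<noteq> 0" "\<And>i. l $ i \<noteq> 0"
    and upper: "\<And>i j (n::nat). n \<ge> 1 \<Longrightarrow> 1 - a $ j * l $ i * q powi (- int n) \<noteq> 0"
    and lower: "\<And>i j (n::nat). 1 - (q * l $ i / b $ j) * q ^ n \<noteq> 0"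
    and balance: "a $ 1 * a $ 2 * a $ 3 * b $ 1 * b $ 2 * b $ 3 = q"
    and t: "t = a $ 1 * a $ 2 * a $ 3"
  shows "det (vector [vector [f1 q b (l $ 1), f2 q a (l $ 1), f3 q a b (l $ 1)],
                      vector [f1 q b (l $ 2), f2 q a (l $ 2), f3 q a b (l $ 2)],
                      vector [f1 q b (l $ 3), f2 q a (l $ 3), f3 q a b (l $ 3)]]
                :: complex ^ 3 ^ 3) =
    qpoch_inf q q * qtheta q (t * l $ 1 * l $ 2 * l $ 3) / (l $ 1 * l $ 2 * l $ 3) *
    (\<Prod>i\<in>UNIV. \<Prod>j\<in>UNIV. qpoch_inf q (q / (a $ i * b $ j))) *
    (\<Prod>(i, j)\<in>{(1, 2), (1, 3), (2, 3)}. l $ j * qtheta q (l $ i / l $ j))"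
proof -
  interpret q_base q by unfold_locales (use q in auto)
  have f3: "f3 q a b (l $ i) = F3 (a $ 1) (a $ 2) (a $ 3) (b $ 1) (b $ 2) (b $ 3) (l $ i)" for i
    by (rule f3_eq) (use nonzero upper lower in auto)
  have "determinant_formula (a $ 1) (a $ 2) (a $ 3) (b $ 1) (b $ 2) (b $ 3) (l $ 1) (l $ 2) (l $ 3)"
    by (rule determinant_formula_holds) (use nonzero balance in \<open>auto simp: mult_ac\<close>)
  then have formula: "theta_det (a $ 1) (a $ 2) (a $ 3) (b $ 1) (b $ 2) (b $ 3) (l $ 1) (l $ 2) (l $ 3) =
      qpoch_inf q q * pair_product (a $ 1) (a $ 2) (a $ 3) (b $ 1) (b $ 2) (b $ 3) * theta_vandermonde t (l $ 1) (l $ 2) (l $ 3)"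
    unfolding determinant_formula_def t .
  have P: "(\<Prod>i\<in>UNIV. \<Prod>j\<in>UNIV. qpoch_inf q (q / (a $ i * b $ j))) =
      pair_product (a $ 1) (a $ 2) (a $ 3) (b $ 1) (b $ 2) (b $ 3)"
    by (simp add: prod_UNIV_3 pair_product_def mult_ac)
  have V: "qtheta q (t * l $ 1 * l $ 2 * l $ 3) / (l $ 1 * l $ 2 * l $ 3) *
      (\<Prod>(i, j)\<in>{(1, 2), (1, 3), (2, 3)}. l $ j * qtheta q (l $ i / l $ j)) = theta_vandermonde t (l $ 1) (l $ 2) (l $ 3)"
    by (simp add: theta_vandermonde_def mult_ac)
  have "det (vector [vector [f1 q b (l $ 1), f2 q a (l $ 1), f3 q a b (l $ 1)],
                      vector [f1 q b (l $ 2), f2 q a (l $ 2), f3 q a b (l $ 2)],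
                      vector [f1 q b (l $ 3), f2 q a (l $ 3), f3 q a b (l $ 3)]]
                :: complex ^ 3 ^ 3) =
      theta_det (a $ 1) (a $ 2) (a $ 3) (b $ 1) (b $ 2) (b $ 3) (l $ 1) (l $ 2) (l $ 3)"
    unfolding f1_eq f2_eq f3 by (simp add: det_3 vector_3 theta_det_def det3_def)
  also have "\<dots> = qpoch_inf q q * pair_product (a $ 1) (a $ 2) (a $ 3) (b $ 1) (b $ 2) (b $ 3) * theta_vandermonde t (l $ 1) (l $ 2) (l $ 3)"
    by (rule formula)
  finally show ?thesis
    unfolding P V[symmetric] by (simp add: mult_ac)
qed

end
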